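(* Let $\mathcal{C}$ be a half-line CMV matrix with spectral measure $\mu$ and let $\Phi_n$ be the associated monic orthogonal polynomials. (a) If either all right limits of $\mathcal{C}$ are in $\mathcal{K}(\infty)$, or $\mathcal{C}$ has a unique right limit (up to multiplication of the Verblunsky coefficients by a constant phase) in $\widetilde{\mathcal{K}}(c,1)$ (for some $c\in\overline{\mathbb{D}}\setminus\{0\}$), then $\mu$ is ratio asymptotic. (b) Conversely, if ratio asymptotics holds at some point $z_0\in\mathbb{D}\setminus\{0\}$ with limit $G(z_0)=1$, then all right limits of $\mathcal{C}$ are in $\mathcal{K}(\infty)$. (c) If ratio asymptotics holds at two (distinct) points $z_1,z_2\in\mathbb{D}\setminus\{0\}$ and the limit is not $1$ at either point, then $\mathcal{C}$ has a unique right limit (up to multiplication by a constant phase) in $\widetilde{\mathcal{K}}(c,1)$ for some $c\in\overline{\mathbb{D}}\setminus\{0\}$. Here "$\mathcal{C}$ has a unique right limit up to multiplication by a constant phase in $\widetilde{\mathcal{K}}(c,1)$" means that all right limits of $\mathcal{C}$ lie in $\widetilde{\mathcal{K}}(c,1)$ and any two of them have Verblunsky coefficient sequences $\{\beta_n\}_{n\in\mathbb{Z}}$, $\{\beta'_n\}_{n\in\mathbb{Z}}$ with $\beta'_n=e^{i\phi}\beta_n$ for all $n$, for some $\phi\in\mathbb{R}$.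
   Context: $\mathbb{D}$ is the open unit disc. A probability measure $\mu$ on $\partial\mathbb{D}$ with infinite support has monic orthogonal polynomials $\Phi_n$ satisfying $\Phi_{n+1}(z)=z\Phi_n(z)-\overline{\alpha_n}\,\Phi_n^*(z)$, $\Phi_n^*(z)=z^n\overline{\Phi_n(1/\bar z)}$; the numbers $\alpha_n\in\mathbb{D}$ are its Verblunsky coefficients, and $\mu\leftrightarrow\{\alpha_n\}_{n\ge0}\in\mathbb{D}^{\mathbb{Z}_+}$ is a bijection. The half-line CMV matrix of $\{\alpha_n\}_{n\ge 0}$ is the unitary operator on $\ell^2(\mathbb{Z}_+)$ given by $\mathcal{C}=\mathcal{L}\mathcal{M}$, $\mathcal{L}=\Theta_0\oplus\Theta_2\oplus\cdots$, $\mathcal{M}=(1)\oplus\Theta_1\oplus\Theta_3\oplus\cdots$, $\Theta_k=\begin{pmatrix}\bar\alpha_k&\rho_k\\ \rho_k&-\alpha_k\end{pmatrix}$, $\rho_k=(1-|\alpha_k|^2)^{1/2}$; $\mu$ is its spectral measure. Ratio asymptotics holds at $z\in\mathbb{D}$ with limit $G(z)$ if $\lim_{n\to\infty}\Phi^*_{n+1}(z)/\Phi^*_n(z)=G(z)$; $\mu$ is ratio asymptotic if this limit exists for all $z\in\mathbb{D}$. For $\{\beta_n\}_{n\in\mathbb{Z}}$ with $|\beta_n|\le1$, the whole-line CMV matrix is the unitary operator $\mathcal{E}=\mathcal{L}\mathcal{M}$ on $\ell^2(\mathbb{Z})$, with $\mathcal{L}$ the direct sum over $k\in\mathbb{Z}$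 of blocks $\Theta_{2k}$ acting on coordinates $2k,2k+1$ and $\mathcal{M}$ the direct sum of blocks $\Theta_{2k-1}$ acting on coordinates $2k-1,2k$ (with $\Theta_k$ formed from $\beta_k$). $\mathcal{E}$ is a right limit of $\mathcal{C}$ if there are integers $n_j\to\infty$ with $\beta_n=\lim_{j\to\infty}\alpha_{n+n_j}$ for every $n\in\mathbb{Z}$. A whole-line CMV matrix $\mathcal{E}$ belongs to Khrushchev Class if the spectral measures of $\mathcal{E}$ and $\delta_n$ are the same for all $n\in\mathbb{Z}$. $\mathcal{K}(\infty)$ is the set of whole-line CMV matrices with $[\mathcal{E}^\ell]_{n,n}=0$ for all $n\in\mathbb{Z}$, $\ell\ge1$. For $c\in\overline{\mathbb{D}}\setminus\{0\}$, $\mathcal{K}(c,1)$ is the set of matrices in the Khrushchev Class with $\mathcal{E}_{n,n}=c$ for all $n\in\mathbb{Z}$, and $\widetilde{\mathcal{K}}(c,1)$ is the subclass of $\mathcal{K}(c,1)$ consisting of CMV matrices whose Verblunsky coefficients $\beta_n$ have constant absolute value ($|\beta_n|$ independent of $n$). *)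

theory Defs
  imports "HOL-Analysis.Analysis" "HOL-Computational_Algebra.Polynomial"
begin

section \<open>Sequence spaces and spectral measures\<close>

text \<open>
  Operators on \<open>\<ell>\<^sup>2(I)\<close> are represented by maps on all sequences \<open>I \<Rightarrow> complex\<close>.
  This is harmless for CMV matrices: they have finitely many nonzero entries in each row
  and column, so they act on every sequence, and they map \<open>\<ell>\<^sup>2\<close> to itself.
\<close>

type_synonym 'i seq_op = "('i \<Rightarrow> complex) \<Rightarrow> ('i \<Rightarrow> complex)"

definition delta :: "'i \<Rightarrow> 'i \<Rightarrow> complex" where
  "delta n = (\<lambda>m. if m = n then 1 else 0)"

definition ell2_inner :: "('i \<Rightarrow> complex) \<Rightarrow> ('i \<Rightarrow> complex) \<Rightarrow> complex" where
  "ell2_inner u v = (\<Sum>\<^sub>\<infinity>n. cnj (u n) * v n)"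

definition entry :: "'i seq_op \<Rightarrow> 'i \<Rightarrow> 'i \<Rightarrow> complex" where
  "entry U m n = ell2_inner (delta m) (U (delta n))"

text \<open>
  The spectral measure of a unitary operator and a vector.  The moments with negative
  exponents are the complex conjugates of those below, so a measure on the circle is
  determined by these conditions.
\<close>

definition is_spectral_measure :: "'i seq_op \<Rightarrow> ('i \<Rightarrow> complex) \<Rightarrow> complex measure \<Rightarrow> bool" where
  "is_spectral_measure U v \<nu> \<longleftrightarrow>
     sets \<nu> = sets borel \<and> finite_measure \<nu> \<and> emeasure \<nu> (- sphere 0 1) = 0 \<and>
     (\<forall>k::nat. (LINT z|\<nu>. z ^ k) = ell2_inner v ((U ^^ k) v))"

lemma ell2_inner_delta: "ell2_inner (delta n) v = v n"
proof -
  have "ell2_inner (delta n) v = (\<Sum>\<^sub>\<infinity>m\<in>{n}. v m)"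
    unfolding ell2_inner_def delta_def by (rule infsum_cong_neutral) auto
  then show ?thesis by simp
qed

section \<open>Orthogonal polynomials on the unit circle\<close>

definition is_monic_OP :: "complex measure \<Rightarrow> nat \<Rightarrow> complex poly \<Rightarrow> bool" where
  "is_monic_OP \<mu> n p \<longleftrightarrow>
     degree p = n \<and> lead_coeff p = 1 \<and>
     (\<forall>j<n. (LINT z|\<mu>. cnj (z ^ j) * poly p z) = 0)"

text \<open>
  The reversed polynomial \<open>p\<^sup>*(z) = z\<^sup>n * cnj (p (1 / cnj z))\<close>, \<open>n = degree p\<close>.  It is defined through its
  coefficients, since that formula has to be read as a polynomial identity at \<open>z = 0\<close>.
\<close>

definition rev_poly :: "complex poly \<Rightarrow> complex poly" where
  "rev_poly p = reflect_poly (map_poly cnj p)"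

lemma poly_rev_poly:
  assumes "z \<noteq> 0"
  shows "poly (rev_poly p) z = z ^ degree p * cnj (poly p (1 / cnj z))"
proof -
  have "degree (map_poly cnj p) = degree p" by (rule degree_map_poly) simp
  moreover have "poly (map_poly cnj p) (inverse z) = cnj (poly p (1 / cnj z))"
    by (induction p) (auto simp: map_poly_pCons inverse_eq_divide)
  ultimately show ?thesis
    using assms by (simp add: rev_poly_def poly_reflect_poly_nz)
qed

definition ratio_asymptotics_at :: "(nat \<Rightarrow> complex poly) \<Rightarrow> complex \<Rightarrow> complex \<Rightarrow> bool" where
  "ratio_asymptotics_at \<Phi> z G \<longleftrightarrow>
     (\<lambda>n. poly (rev_poly (\<Phi> (Suc n))) z / poly (rev_poly (\<Phi> n)) z) \<longlonglongrightarrow> G"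

definition ratio_asymptotic :: "(nat \<Rightarrow> complex poly) \<Rightarrow> bool" where
  "ratio_asymptotic \<Phi> \<longleftrightarrow> (\<forall>z\<in>ball 0 1. \<exists>G. ratio_asymptotics_at \<Phi> z G)"

section \<open>CMV matrices\<close>

definition rho :: "complex \<Rightarrow> complex" where
  "rho a = of_real (sqrt (1 - (cmod a)\<^sup>2))"

text \<open>
  The two coordinates of the block \<open>\<Theta> = ((cnj a, rho a), (rho a, - a))\<close> applied to \<open>(x, y)\<close>.
\<close>

definition Theta1 :: "complex \<Rightarrow> complex \<Rightarrow> complex \<Rightarrow> complex" where
  "Theta1 a x y = cnj a * x + rho a * y"

definition Theta2 :: "complex \<Rightarrow> complex \<Rightarrow> complex \<Rightarrow> complex" where
  "Theta2 a x y = rho a * x - a * y"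

text \<open>The block built from the coefficient with index \<open>k\<close> acts on the coordinates \<open>k, k + 1\<close>.\<close>

definition half_L :: "(nat \<Rightarrow> complex) \<Rightarrow> nat seq_op" where
  "half_L \<alpha> u = (\<lambda>n. if even n then Theta1 (\<alpha> n) (u n) (u (n + 1))
                     else Theta2 (\<alpha> (n - 1)) (u (n - 1)) (u n))"

definition half_M :: "(nat \<Rightarrow> complex) \<Rightarrow> nat seq_op" where
  "half_M \<alpha> u = (\<lambda>n. if n = 0 then u 0
                     else if odd n then Theta1 (\<alpha> n) (u n) (u (n + 1))
                     else Theta2 (\<alpha> (n - 1)) (u (n - 1)) (u n))"

definition half_CMV :: "(nat \<Rightarrow> complex) \<Rightarrow> nat seq_op" where
  "half_CMV \<alpha> = half_L \<alpha> \<circ> half_M \<alpha>"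

definition whole_L :: "(int \<Rightarrow> complex) \<Rightarrow> int seq_op" where
  "whole_L \<beta> u = (\<lambda>n. if even n then Theta1 (\<beta> n) (u n) (u (n + 1))
                      else Theta2 (\<beta> (n - 1)) (u (n - 1)) (u n))"

definition whole_M :: "(int \<Rightarrow> complex) \<Rightarrow> int seq_op" where
  "whole_M \<beta> u = (\<lambda>n. if odd n then Theta1 (\<beta> n) (u n) (u (n + 1))
                      else Theta2 (\<beta> (n - 1)) (u (n - 1)) (u n))"

definition whole_CMV :: "(int \<Rightarrow> complex) \<Rightarrow> int seq_op" where
  "whole_CMV \<beta> = whole_L \<beta> \<circ> whole_M \<beta>"

definition whole_CMV_matrices :: "int seq_op set" where
  "whole_CMV_matrices = {whole_CMV \<beta> | \<beta>. \<forall>n. cmod (\<beta> n) \<le> 1}"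

section \<open>Right limits and the Khrushchev classes\<close>

text \<open>
  \<open>whole_CMV \<beta>\<close> is a right limit of \<open>half_CMV \<alpha>\<close>.  For fixed \<open>n\<close> the index \<open>n + N j\<close> is
  negative for at most finitely many \<open>j\<close>, so the truncation by \<open>nat\<close> does not affect the limit.
\<close>

definition is_right_limit :: "(nat \<Rightarrow> complex) \<Rightarrow> (int \<Rightarrow> complex) \<Rightarrow> bool" where
  "is_right_limit \<alpha> \<beta> \<longleftrightarrow>
     (\<exists>N :: nat \<Rightarrow> int. filterlim N at_top sequentially \<and>
        (\<forall>n. (\<lambda>j. \<alpha> (nat (n + N j))) \<longlonglongrightarrow> \<beta> n))"

definition Khrushchev_class :: "int seq_op set" where
  "Khrushchev_class =
     {E \<in> whole_CMV_matrices. \<exists>\<nu>. \<forall>n. is_spectral_measure E (delta n) \<nu>}"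

definition K_infty :: "int seq_op set" where
  "K_infty = {E \<in> whole_CMV_matrices. \<forall>n. \<forall>l\<ge>1. entry (E ^^ l) n n = 0}"

definition K1 :: "complex \<Rightarrow> int seq_op set" where
  "K1 c = {E \<in> Khrushchev_class. \<forall>n. entry E n n = c}"

definition K1_tilde :: "complex \<Rightarrow> int seq_op set" where
  "K1_tilde c = {whole_CMV \<beta> | \<beta>. (\<forall>n. cmod (\<beta> n) \<le> 1) \<and> whole_CMV \<beta> \<in> K1 c \<and>
                                   (\<forall>m n. cmod (\<beta> m) = cmod (\<beta> n))}"

definition all_right_limits_in :: "(nat \<Rightarrow> complex) \<Rightarrow> int seq_op set \<Rightarrow> bool" where
  "all_right_limits_in \<alpha> S \<longleftrightarrow> (\<forall>\<beta>. is_right_limit \<alpha> \<beta> \<longrightarrow> whole_CMV \<beta> \<in> S)"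

definition unique_right_limit_in :: "(nat \<Rightarrow> complex) \<Rightarrow> int seq_op set \<Rightarrow> bool" where
  "unique_right_limit_in \<alpha> S \<longleftrightarrow>
     all_right_limits_in \<alpha> S \<and>
     (\<forall>\<beta> \<beta>'. is_right_limit \<alpha> \<beta> \<and> is_right_limit \<alpha> \<beta>' \<longrightarrow>
        (\<exists>\<phi>::real. \<forall>n. \<beta>' n = cis \<phi> * \<beta> n))"

end

theory Submission imports Defs "HOL-Probability.Probability" begin

text \<open>
  The quotients \<open>b n = \<Phi> n / \<Phi> n\<^sup>*\<close> map the disc into its closure and satisfy
  \<open>b (n + 1) = (z b n - cnj (\<alpha> n)) / (1 - \<alpha> n z b n)\<close>, while
  \<open>\<Phi> (n + 1)\<^sup>* / \<Phi> n\<^sup>* = 1 - z \<alpha> n b n\<close>.  Along a sequence defining a right limit \<open>\<beta>\<close> they converge to a two-sided orbit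
  of the same recursion, and a Schwarz-Pick contraction shows that \<open>\<beta>\<close> has only one such orbit \<open>w\<close> at each \<open>z\<close>.
  Hence ratio asymptotics at \<open>z\<close> means that \<open>\<beta> n w n\<close> is the same number for all \<open>n\<close> and all right limits, which
  gives (a) for a right limit unique up to a phase.  If that number is \<open>0\<close>, at most one \<open>\<beta> n\<close> is nonzero, and
  following paths of the CMV matrix identifies this with membership in \<open>K_infty\<close>.  If it is nonzero, the recursion
  expresses \<open>\<beta> (n + 1) / \<beta> n\<close> through \<open>\<bar>\<beta> n\<bar>\<^sup>2\<close>, and a second point determines both; then \<open>\<beta> (n + 1) = \<omega> \<beta> n\<close>, so
  translation is a symmetry of the whole-line matrix and all \<open>\<delta> n\<close> have the same spectral measure.
\<close>

section \<open>Factors of CMV matrices\<close>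

text \<open>The polynomials \<open>\<Phi> n\<close> are given only by orthogonality for a measure
  known through its moments, so the recursion that drives the argument has to be recovered from the
  matrix. Alternating products of its two factors turn the polynomials into images of basis vectors;
  therefore \<open>L\<close> and \<open>M\<close> are made instances of one map
  \<open>half_step p\<close>, of which only the parity of \<open>p\<close> matters. Vectors of
  finite support suffice throughout, which keeps every inner product a finite sum. Right limits can
  have coefficients of modulus 1 and limits of the quotients can reach the unit circle, so orbits
  live in the closed disc, where the hyperbolic distance may be infinite. At z = 0 the ratio is
  always 1, hence the exclusion of 0. One point with limit other than 1 gives a single relation
  between two unknowns, |\<beta> n|^2 and \<beta> (n + 1) / \<beta> n, hence the two points. The
  Khrushchev class asks for a measure and not just for equal moments, so a trigonometric moment
  problem has to be solved.\<close>

definition half_step :: "int \<Rightarrow> (int \<Rightarrow> complex) \<Rightarrow> int seq_op" where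
  "half_step p \<beta> u = (\<lambda>j. if even (j - p) then Theta1 (\<beta> j) (u j) (u (j + 1))
                          else Theta2 (\<beta> (j - 1)) (u (j - 1)) (u j))"

lemma whole_L_eq: "whole_L = half_step 0"
  by (intro ext) (simp add: whole_L_def half_step_def)

lemma whole_M_eq: "whole_M = half_step 1"
  by (intro ext) (simp add: whole_M_def half_step_def)

lemma whole_CMV_eq: "whole_CMV \<beta> = half_step 0 \<beta> \<circ> half_step 1 \<beta>"
  by (simp add: whole_CMV_def whole_L_eq whole_M_eq)

lemma half_step_cong: "even (p - q) \<Longrightarrow> half_step p = half_step q"
  by (intro ext) (auto simp: half_step_def)

section \<open>Finite support, linearity and the pairing\<close>

abbreviation finsupp :: "('i \<Rightarrow> complex) \<Rightarrow> bool" where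
  "finsupp u \<equiv> finite {i. u i \<noteq> 0}"

lemma finsupp_delta: "finsupp (delta n)"
  by (rule finite_subset[of _ "{n}"]) (auto simp: delta_def)

lemma finsupp_half_step:
  assumes "finsupp u"
  shows "finsupp (half_step p \<beta> u)"
proof -
  let ?A = "{i. u i \<noteq> 0}"
  have "{i. half_step p \<beta> u i \<noteq> 0} \<subseteq> ?A \<union> (\<lambda>i. i - 1) ` ?A \<union> (\<lambda>i. i + 1) ` ?A"
  proof
    fix i assume "i \<in> {i. half_step p \<beta> u i \<noteq> 0}"
    then have "u i \<noteq> 0 \<or> u (i + 1) \<noteq> 0 \<or> u (i - 1) \<noteq> 0"
      by (auto simp: half_step_def Theta1_def Theta2_def split: if_splits)
    then show "i \<in> ?A \<union> (\<lambda>i. i - 1) ` ?A \<union> (\<lambda>i. i + 1) ` ?A"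
      by (auto simp: image_iff intro: exI[of _ "i + 1"] exI[of _ "i - 1"])
  qed
  then show ?thesis using assms by (meson finite_UnI finite_imageI finite_subset)
qed

lemma finsupp_whole_CMV: "finsupp u \<Longrightarrow> finsupp (whole_CMV \<beta> u)"
  by (simp add: whole_CMV_eq finsupp_half_step)

lemma finsupp_whole_CMV_pow: "finsupp u \<Longrightarrow> finsupp ((whole_CMV \<beta> ^^ k) u)"
  by (induction k) (simp_all add: finsupp_whole_CMV)

lemma finsupp_sum:
  assumes "finite A" "\<And>a. a \<in> A \<Longrightarrow> finsupp (f a)"
  shows "finsupp (\<lambda>i. \<Sum>a\<in>A. c a * f a i)"
proof (rule finite_subset)
  show "{i. (\<Sum>a\<in>A. c a * f a i) \<noteq> 0} \<subseteq> (\<Union>a\<in>A. {i. f a i \<noteq> 0})"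
    by (auto intro!: sum.neutral)
  show "finite (\<Union>a\<in>A. {i. f a i \<noteq> 0})" using assms by auto
qed

lemma half_step_linear:
  "half_step p \<beta> (\<lambda>i. \<Sum>a\<in>A. c a * f a i) = (\<lambda>i. \<Sum>a\<in>A. c a * half_step p \<beta> (f a) i)"
  by (rule ext) (auto simp: half_step_def Theta1_def Theta2_def sum_distrib_left
      sum.distrib[symmetric] sum_subtractf[symmetric] algebra_simps)

lemma half_step_add: "half_step p \<beta> (\<lambda>i. u i + v i) = (\<lambda>i. half_step p \<beta> u i + half_step p \<beta> v i)"
  by (rule ext) (auto simp: half_step_def Theta1_def Theta2_def algebra_simps)

lemma half_step_scale: "half_step p \<beta> (\<lambda>i. c * u i) = (\<lambda>i. c * half_step p \<beta> u i)"
  by (rule ext) (auto simp: half_step_def Theta1_def Theta2_def algebra_simps)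

lemma half_step_cnj:
  "half_step p (\<lambda>i. cnj (\<beta> i)) (\<lambda>i. cnj (u i)) = (\<lambda>i. cnj (half_step p \<beta> u i))"
  by (rule ext) (auto simp: half_step_def Theta1_def Theta2_def rho_def)

lemma whole_CMV_linear:
  "whole_CMV \<beta> (\<lambda>i. \<Sum>a\<in>A. c a * f a i) = (\<lambda>i. \<Sum>a\<in>A. c a * whole_CMV \<beta> (f a) i)"
  by (simp add: whole_CMV_eq half_step_linear)

lemma ell2_inner_finite:
  assumes "finite A" "{i. u i \<noteq> 0} \<subseteq> A"
  shows "ell2_inner u v = (\<Sum>i\<in>A. cnj (u i) * v i)"
proof -
  have "ell2_inner u v = (\<Sum>\<^sub>\<infinity>i\<in>A. cnj (u i) * v i)"
    unfolding ell2_inner_def by (rule infsum_cong_neutral) (use assms in auto)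
  then show ?thesis using assms by simp
qed

lemma ell2_inner_commute: "ell2_inner v u = cnj (ell2_inner u v)"
  by (simp add: ell2_inner_def infsum_cnj[symmetric] mult.commute)

lemma ell2_inner_sum_right:
  assumes "finsupp u"
  shows "ell2_inner u (\<lambda>i. \<Sum>a\<in>A. c a * f a i) = (\<Sum>a\<in>A. c a * ell2_inner u (f a))"
  unfolding ell2_inner_finite[OF assms order_refl]
  by (subst sum_distrib_left, subst sum.swap) (simp add: sum_distrib_left mult_ac)

lemma ell2_inner_sum_left:
  assumes "finsupp u"
  shows "ell2_inner (\<lambda>i. \<Sum>a\<in>A. c a * f a i) u = (\<Sum>a\<in>A. cnj (c a) * ell2_inner (f a) u)"
proof -
  have "ell2_inner (\<lambda>i. \<Sum>a\<in>A. c a * f a i) u = cnj (\<Sum>a\<in>A. c a * ell2_inner u (f a))"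
    by (subst ell2_inner_commute) (simp only: ell2_inner_sum_right[OF assms])
  moreover have "cnj (ell2_inner u (f a)) = ell2_inner (f a) u" for a
    by (rule ell2_inner_commute[symmetric])
  ultimately show ?thesis by simp
qed


lemma ell2_inner_scale:
  "finsupp u \<Longrightarrow> ell2_inner (\<lambda>i. a * u i) (\<lambda>i. b * v i) = cnj a * b * ell2_inner u v"
proof -
  assume f: "finsupp u"
  have "{i. a * u i \<noteq> 0} \<subseteq> {i. u i \<noteq> 0}" by auto
  then show ?thesis by (simp add: ell2_inner_finite[OF f] sum_distrib_left mult_ac)
qed

lemma ell2_inner_delta_delta: "ell2_inner (delta m) (delta n) = (if m = n then 1 else 0)"
  unfolding ell2_inner_delta by (simp add: delta_def)

lemma ell2_inner_diff_right:
  assumes "finsupp u"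
  shows "ell2_inner u (\<lambda>i. f i - c * g i) = ell2_inner u f - c * ell2_inner u g"
  by (simp add: ell2_inner_finite[OF assms order_refl] sum_subtractf sum_distrib_left algebra_simps)

text \<open>The summands of the two sides differ by a telescoping term.\<close>

lemma ell2_inner_half_step:
  assumes "finsupp u"
  shows "ell2_inner (half_step p \<beta> u) v = ell2_inner u (half_step p (\<lambda>i. cnj (\<beta> i)) v)"
proof -
  \<comment> \<open>The diagonal entries of a block cancel. \<open>t j\<close> is what its
    off-diagonal entries contribute at the first coordinate \<open>j\<close>; the second coordinate
    contributes \<open>- t j\<close>.\<close>
  define t where "t j = (if even (j - p) then
      rho (\<beta> j) * (cnj (u (j + 1)) * v j - cnj (u j) * v (j + 1)) else 0)" for j
  let ?U = "{i. u i \<noteq> 0} \<union> {i. half_step p \<beta> u i \<noteq> 0}"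
  have fU: "finite ?U" using assms finsupp_half_step by auto
  have ft: "finite {j. t j \<noteq> 0}"
  proof (rule finite_subset)
    show "{j. t j \<noteq> 0} \<subseteq> {i. u i \<noteq> 0} \<union> (\<lambda>i. i - 1) ` {i. u i \<noteq> 0}"
    proof
      fix j assume "j \<in> {j. t j \<noteq> 0}"
      then have "u j \<noteq> 0 \<or> u (j + 1) \<noteq> 0" by (auto simp: t_def split: if_splits)
      then show "j \<in> {i. u i \<noteq> 0} \<union> (\<lambda>i. i - 1) ` {i. u i \<noteq> 0}"
        by (auto simp: image_iff intro: exI[of _ "j + 1"])
    qed
  qed (use assms in auto)
  have diff: "cnj (half_step p \<beta> u j) * v j - cnj (u j) * half_step p (\<lambda>i. cnj (\<beta> i)) v j
      = t j - t (j - 1)" for j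
    by (auto simp: half_step_def t_def Theta1_def Theta2_def rho_def algebra_simps)
  define B where "B = ?U \<union> {j. t j \<noteq> 0} \<union> (\<lambda>j. j + 1) ` {j. t j \<noteq> 0}"
  have fB: "finite B" using fU ft by (auto simp: B_def)
  have "(\<Sum>j\<in>B. t (j - 1)) = (\<Sum>j\<in>(\<lambda>j. j - 1) ` B. t j)"
    by (subst sum.reindex) (auto simp: inj_on_def)
  also have "\<dots> = (\<Sum>j | t j \<noteq> 0. t j)"
  proof (rule sum.mono_neutral_right)
    show "{j. t j \<noteq> 0} \<subseteq> (\<lambda>j. j - 1) ` B"
    proof
      fix j assume "j \<in> {j. t j \<noteq> 0}"
      then have "j + 1 \<in> B" by (auto simp: B_def)
      then show "j \<in> (\<lambda>j. j - 1) ` B" by (metis add_diff_cancel_right' image_eqI)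
    qed
  qed (use fB in auto)
  also have "\<dots> = (\<Sum>j\<in>B. t j)"
    by (rule sum.mono_neutral_left) (use fB in \<open>auto simp: B_def\<close>)
  finally have "(\<Sum>j\<in>B. t j - t (j - 1)) = 0" by (simp add: sum_subtractf)
  then have "(\<Sum>j\<in>B. cnj (half_step p \<beta> u j) * v j)
      = (\<Sum>j\<in>B. cnj (u j) * half_step p (\<lambda>i. cnj (\<beta> i)) v j)"
    by (simp add: diff[symmetric] sum_subtractf)
  moreover have "{i. u i \<noteq> 0} \<subseteq> B" "{i. half_step p \<beta> u i \<noteq> 0} \<subseteq> B" by (auto simp: B_def)
  ultimately show ?thesis using fB by (simp add: ell2_inner_finite[of B])
qed

section \<open>Unitarity\<close>

lemma rho_square: "cmod a \<le> 1 \<Longrightarrow> rho a * rho a = 1 - a * cnj a"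
proof -
  assume "cmod a \<le> 1"
  then have "(cmod a)\<^sup>2 \<le> 1" by (simp add: power_le_one)
  then have "rho a * rho a = of_real (1 - (cmod a)\<^sup>2)"
    unfolding rho_def of_real_mult[symmetric] by simp
  then show ?thesis by (simp only: of_real_diff complex_norm_square of_real_1)
qed

text \<open>Since the blocks are symmetric and \<open>rho\<close> is real, conjugating the
  coefficients gives the adjoint block, and adjoint times block is 1 by \<open>rho_square\<close>.
  Coefficients of modulus 1 are included.\<close>

lemma half_step_inverse:
  assumes "\<And>i. cmod (\<beta> i) \<le> 1"
  shows "half_step p (\<lambda>i. cnj (\<beta> i)) (half_step p \<beta> u) = u"
proof
  fix j
  have "rho (cnj (\<beta> i)) = rho (\<beta> i)" for i by (simp add: rho_def)
  then show "half_step p (\<lambda>i. cnj (\<beta> i)) (half_step p \<beta> u) j = u j"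
    using rho_square[OF assms, of j] rho_square[OF assms, of "j - 1"]
    by (auto simp: half_step_def Theta1_def Theta2_def distrib_left right_diff_distrib
        mult.assoc[symmetric]) (simp_all add: algebra_simps)
qed

lemma half_step_isometry:
  assumes "\<And>i. cmod (\<beta> i) \<le> 1" "finsupp u"
  shows "ell2_inner (half_step p \<beta> u) (half_step p \<beta> v) = ell2_inner u v"
  by (simp add: ell2_inner_half_step half_step_inverse assms)

lemma whole_CMV_isometry:
  assumes "\<And>i. cmod (\<beta> i) \<le> 1" "finsupp u"
  shows "ell2_inner (whole_CMV \<beta> u) (whole_CMV \<beta> v) = ell2_inner u v"
  by (simp add: whole_CMV_eq half_step_isometry finsupp_half_step assms)

lemma whole_CMV_pow_isometry:
  assumes "\<And>i. cmod (\<beta> i) \<le> 1" "finsupp u"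
  shows "ell2_inner ((whole_CMV \<beta> ^^ k) u) ((whole_CMV \<beta> ^^ k) v) = ell2_inner u v"
  by (induction k) (simp_all add: whole_CMV_isometry finsupp_whole_CMV_pow assms)

lemma ell2_inner_cnj: "ell2_inner (\<lambda>i. cnj (u i)) (delta n) = u n"
  by (subst ell2_inner_commute) (simp add: ell2_inner_delta)

text \<open>The blocks are symmetric matrices, so \<open>M L\<close> is the transpose of \<open>L M\<close>.\<close>

lemma half_step_pow_transpose:
  "((half_step p \<beta> \<circ> half_step q \<beta>) ^^ l) (delta n) n = ((half_step q \<beta> \<circ> half_step p \<beta>) ^^ l) (delta n) n"
proof -
  let ?E = "half_step p \<beta> \<circ> half_step q \<beta>" and ?F = "half_step q \<beta> \<circ> half_step p \<beta>"
  let ?F' = "half_step q (\<lambda>i. cnj (\<beta> i)) \<circ> half_step p (\<lambda>i. cnj (\<beta> i))"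
  have fs: "finsupp ((?F' ^^ l) (delta n))" for l
    by (induction l) (simp_all add: finsupp_delta finsupp_half_step)
  have cn: "(?F' ^^ l) (delta n) = (\<lambda>i. cnj ((?F ^^ l) (delta n) i))" for l
  proof (induction l)
    case 0 show ?case by (rule ext) (simp add: delta_def)
  next
    case (Suc l) then show ?case by (simp add: half_step_cnj)
  qed
  have "ell2_inner (delta n) ((?E ^^ l) v) = ell2_inner ((?F' ^^ l) (delta n)) v" for v
  proof (induction l arbitrary: v)
    case 0 show ?case by simp
  next
    case (Suc l)
    have "ell2_inner (delta n) ((?E ^^ Suc l) v) = ell2_inner (delta n) ((?E ^^ l) (?E v))"
      by (simp only: funpow_Suc_right comp_apply)
    also have "\<dots> = ell2_inner ((?F' ^^ l) (delta n)) (?E v)" by (rule Suc.IH)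
    also have "\<dots> = ell2_inner ((?F' ^^ Suc l) (delta n)) v"
      by (simp add: ell2_inner_half_step fs finsupp_half_step)
    finally show ?case .
  qed
  from this[of "delta n"] show ?thesis
    by (simp add: ell2_inner_delta cn ell2_inner_cnj)
qed

section \<open>Symmetry under translation and phase\<close>

lemma half_step_shift:
  "(\<lambda>j. half_step p \<beta> u (j + 1)) = half_step (p + 1) (\<lambda>j. \<beta> (j + 1)) (\<lambda>j. u (j + 1))"
  by (rule ext) (auto simp: half_step_def)

text \<open>A common phase of the coefficients is a diagonal change of basis, but for a single
  factor a different one on either side: it acts on sites of parity \<open>p + 1\<close> before and
  of parity \<open>p\<close> after. In an alternating product these fit together, so the whole
  matrix is conjugated by one diagonal unitary.\<close>

lemma half_step_gauge:
  assumes "cmod \<omega> = 1"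
  defines "D \<equiv> \<lambda>p u (j::int). if even (j - p) then cnj \<omega> * u j else u j"
  shows "half_step p (\<lambda>j. \<omega> * \<beta> j) (D (p + 1) u) = D p (half_step p \<beta> u)"
proof -
  have w: "\<omega> * cnj \<omega> = 1" using assms(1) by (simp add: complex_norm_square[symmetric])
  then have e: "\<omega> * a * (cnj \<omega> * b) = a * b" for a b
    by (metis (no_types, lifting) mult.assoc mult.commute mult.left_neutral)
  have r: "rho (\<omega> * a) = rho a" for a using assms(1) by (simp add: rho_def norm_mult)
  show ?thesis
  proof
    fix j
    show "half_step p (\<lambda>j. \<omega> * \<beta> j) (D (p + 1) u) j = D p (half_step p \<beta> u) j"
    proof (cases "even (j - p)")
      case True
      then show ?thesis by (simp add: half_step_def Theta1_def D_def r algebra_simps)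
    next
      case False
      then show ?thesis by (simp add: half_step_def Theta2_def D_def r e)
    qed
  qed
qed

text \<open>Translation by one site exchanges \<open>L\<close> and \<open>M\<close>, which the transposition undoes; the phase
  acquired by the coefficients is removed by conjugation with a diagonal unitary.\<close>

lemma whole_CMV_pow_diag_const:
  assumes "cmod \<omega> = 1" "\<And>n. \<beta> (n + 1) = \<omega> * \<beta> n"
  shows "(whole_CMV \<beta> ^^ l) (delta (n + 1)) (n + 1) = (whole_CMV \<beta> ^^ l) (delta n) n"
proof -
  define \<gamma> where "\<gamma> = (\<lambda>j. \<omega> * \<beta> j)"
  define D where "D = (\<lambda>p u (j::int). if even (j - p) then cnj \<omega> * u j else u j :: complex)"
  have g: "half_step p \<gamma> (D (p + 1) u) = D p (half_step p \<beta> u)" for p u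
    using half_step_gauge[OF assms(1)] by (simp add: \<gamma>_def D_def)
  have sh: "(\<lambda>j. half_step p \<beta> u (j + 1)) = half_step (p + 1) \<gamma> (\<lambda>j. u (j + 1))" for p u
    using half_step_shift[of p \<beta>] by (simp add: \<gamma>_def assms(2))
  have D2: "D (p + 2) = D p" for p by (intro ext) (simp add: D_def)
  have s2: "half_step (p + 2) = half_step p" for p by (rule half_step_cong) simp
  have *: "(\<lambda>j. (whole_CMV \<beta> ^^ l) u (j + 1))
      = ((half_step 1 \<gamma> \<circ> half_step 0 \<gamma>) ^^ l) (\<lambda>j. u (j + 1))" for u
    using s2[of 0] by (induction l) (simp_all add: whole_CMV_eq sh)
  have **: "((half_step 0 \<gamma> \<circ> half_step 1 \<gamma>) ^^ l) (D 0 u) = D 0 ((whole_CMV \<beta> ^^ l) u)" for u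
    using g[of 0] g[of 1] D2[of 0] by (induction l) (simp_all add: whole_CMV_eq)
  have d: "(\<lambda>j. delta (n + 1) (j + 1)) = delta n" for n :: int by (rule ext) (simp add: delta_def)
  have "(whole_CMV \<beta> ^^ l) (delta (n + 1)) (n + 1) = ((half_step 1 \<gamma> \<circ> half_step 0 \<gamma>) ^^ l) (delta n) n"
    using fun_cong[OF *[of "delta (n + 1)"], of n] by (simp add: d)
  also have "\<dots> = ((half_step 0 \<gamma> \<circ> half_step 1 \<gamma>) ^^ l) (delta n) n"
    by (rule half_step_pow_transpose)
  also have "\<dots> = (whole_CMV \<beta> ^^ l) (delta n) n"
  proof -
    let ?c = "if even n then cnj \<omega> else 1"
    have D0: "D 0 (delta n) = (\<lambda>j. ?c * delta n j)" by (rule ext) (auto simp: D_def delta_def)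
    have lin: "((half_step 0 \<gamma> \<circ> half_step 1 \<gamma>) ^^ l) (\<lambda>j. c * u j)
       = (\<lambda>j. c * ((half_step 0 \<gamma> \<circ> half_step 1 \<gamma>) ^^ l) u j)" for c u
      by (induction l) (simp_all add: half_step_scale)
    have "?c * ((half_step 0 \<gamma> \<circ> half_step 1 \<gamma>) ^^ l) (delta n) n = ?c * (whole_CMV \<beta> ^^ l) (delta n) n"
      using fun_cong[OF **[of "delta n"], of n] unfolding D0 lin by (simp add: D_def)
    moreover have "?c \<noteq> 0" using assms(1) by auto
    ultimately show ?thesis using mult_left_cancel by blast
  qed
  finally show ?thesis .
qed

lemma entry_pow: "entry (U ^^ l) m n = (U ^^ l) (delta n) m"
  by (simp add: entry_def ell2_inner_delta)

lemma entry_whole_CMV_diag: "entry (whole_CMV \<beta>) n n = - cnj (\<beta> n) * \<beta> (n - 1)"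
  unfolding entry_def ell2_inner_delta
  by (auto simp: whole_CMV_eq half_step_def Theta1_def Theta2_def delta_def)

section \<open>Existence of spectral measures\<close>

lemma integral_cis_period:
  "(\<integral>t. indicator {0..2*pi} t *\<^sub>R cis (of_int m * t) \<partial>lborel) = (if m = 0 then of_real (2*pi) else 0)"
proof (cases "m = 0")
  case True
  then show ?thesis by (simp add: scaleR_conv_of_real)
next
  case False
  define F where "F t = cis (of_int m * t) / (\<i> * of_int m)" for t :: real
  have "(F has_vector_derivative cis (of_int m * t)) (at t within {0..2*pi})" for t
    unfolding F_def cis_conv_exp
    by (rule derivative_eq_intros has_vector_derivative_real_field | use False in \<open>simp add: field_simps\<close>)+
  then have "(\<integral>t. indicator {0..2*pi} t *\<^sub>R cis (of_int m * t) \<partial>lborel) = F (2*pi) - F 0"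
    by (intro integral_FTC_Icc) (auto intro!: continuous_intros)
  also have "\<dots> = 0"
    using cis_multiple_2pi[of "of_int m"] by (simp add: F_def mult_ac)
  finally show ?thesis using False by simp
qed

text \<open>The squared norm of \<open>\<Sum>k<N. exp (- i k t) u k\<close> is a Fejer mean of the moments, hence a density; the
  spectral measure is a weak limit of these densities.\<close>

lemma trig_moment_problem:
  fixes u :: "nat \<Rightarrow> 'i \<Rightarrow> complex" and c :: "nat \<Rightarrow> complex"
  assumes fs: "\<And>k. finsupp (u k)"
    and c: "\<And>j k. ell2_inner (u j) (u (j + k)) = c k"
    and c0: "c 0 = 1"
  shows "\<exists>\<nu> :: complex measure. sets \<nu> = sets borel \<and> finite_measure \<nu> \<and>
           emeasure \<nu> (- sphere 0 1) = 0 \<and> (\<forall>k::nat. (LINT z|\<nu>. z ^ k) = c k)"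
proof -
  define g where "g N t i = (\<Sum>k<N. cis (- (real k * t)) * u k i)" for N t i
  have gN: "g N t = (\<lambda>i. \<Sum>k<N. cis (- (real k * t)) * u k i)" for N t
    by (simp add: g_def fun_eq_iff)
  define A where "A N = (\<Union>k<N. {i. u k i \<noteq> 0})" for N
  have fA: "finite (A N)" for N using fs by (auto simp: A_def)
  have gA: "{i. g N t i \<noteq> 0} \<subseteq> A N" for N t
    by (auto simp: g_def A_def intro!: sum.neutral)
  have fg: "finsupp (g N t)" for N t using fA gA by (rule finite_subset[rotated])
  \<comment> \<open>The denominator makes the total mass equal to \<open>c 0 = 1\<close>.\<close>
  define p where "p N t = (\<Sum>i\<in>A N. (cmod (g N t i))\<^sup>2) / (2 * pi * real N)" for N t
  define f where "f N t = indicator {0..2*pi} t * p N t" for N t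
  have p0: "p N t \<ge> 0" for N t by (auto simp: p_def intro!: sum_nonneg divide_nonneg_nonneg)
  have f0: "f N t \<ge> 0" for N t using p0 by (auto simp: f_def)
  have pc: "continuous_on UNIV (p N)" for N unfolding p_def g_def
    by (cases "N = 0") (auto intro!: continuous_intros)
  have pm[measurable]: "p N \<in> borel_measurable borel" for N
    using pc by (rule borel_measurable_continuous_onI)
  have fm[measurable]: "f N \<in> borel_measurable borel" for N unfolding f_def by measurable
  define e where "e j k = ell2_inner (u j) (u k)" for j k
  have e1: "e j k = c (k - j)" if "j \<le> k" for j k using c[of j "k - j"] that by (simp add: e_def)
  have pe: "complex_of_real (p N t) = (\<Sum>j<N. \<Sum>k<N. cis ((real j - real k) * t) * e j k) / of_real (2 * pi * real N)" for N t
  proof -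
    have "complex_of_real (\<Sum>i\<in>A N. (cmod (g N t i))\<^sup>2) = ell2_inner (g N t) (g N t)"
      unfolding ell2_inner_finite[OF fA gA] of_real_sum complex_norm_square by (simp add: mult.commute)
    also have "\<dots> = (\<Sum>k<N. cis (- (real k * t)) * ell2_inner (g N t) (u k))"
      by (subst (2) gN) (rule ell2_inner_sum_right[OF fg])
    also have "\<dots> = (\<Sum>k<N. cis (- (real k * t)) * (\<Sum>j<N. cnj (cis (- (real j * t))) * e j k))"
      by (simp add: gN e_def ell2_inner_sum_left[OF fs])
    also have "\<dots> = (\<Sum>k<N. \<Sum>j<N. cis ((real j - real k) * t) * e j k)"
    proof -
      have e: "cis (- (real k * t)) * (cnj (cis (- (real j * t))) * x) = cis ((real j - real k) * t) * x" for j k x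
        by (simp add: cis_cnj mult.assoc[symmetric] cis_mult left_diff_distrib)
      show ?thesis unfolding sum_distrib_left e ..
    qed
    finally show ?thesis by (subst sum.swap) (simp add: p_def)
  qed
  \<comment> \<open>Integration keeps only the pairs with \<open>k = l + j\<close>; there are
    \<open>N - l\<close> of them, which produces the Fejer factor (N - l) / N.\<close>
  have mom: "(\<integral>t. f N t *\<^sub>R cis (real l * t) \<partial>lborel) = of_real ((real N - real l) / real N) * c l"
    if "N > 0" "l \<le> N" for l N
  proof -
    have "(\<integral>t. f N t *\<^sub>R cis (real l * t) \<partial>lborel) =
       (\<integral>t. (\<Sum>j<N. \<Sum>k<N. (e j k / of_real (2 * pi * real N)) * (indicator {0..2*pi} t *\<^sub>R cis (of_int (int l + int j - int k) * t))) \<partial>lborel)"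
    proof (rule Bochner_Integration.integral_cong[OF refl])
      fix t :: real
      have "f N t *\<^sub>R cis (real l * t) = of_real (indicator {0..2*pi} t) * (of_real (p N t) * cis (real l * t))"
        by (simp add: f_def scaleR_conv_of_real)
      also have "\<dots> = (\<Sum>j<N. \<Sum>k<N. (e j k / of_real (2 * pi * real N)) * (of_real (indicator {0..2*pi} t) * cis (of_int (int l + int j - int k) * t)))"
        unfolding pe sum_divide_distrib sum_distrib_left sum_distrib_right
      proof (intro sum.cong refl)
        fix j k
        have "cis (of_int (int l + int j - int k) * t) = cis ((real j - real k) * t) * cis (real l * t)"
          by (simp add: cis_mult algebra_simps)
        then show "of_real (indicator {0..2*pi} t) * (cis ((real j - real k) * t) * e j k / of_real (2 * pi * real N) * cis (real l * t))
          = (e j k / of_real (2 * pi * real N)) * (of_real (indicator {0..2*pi} t) * cis (of_int (int l + int j - int k) * t))"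
          by simp
      qed
      finally show "f N t *\<^sub>R cis (real l * t) = (\<Sum>j<N. \<Sum>k<N. (e j k / of_real (2 * pi * real N)) * (indicator {0..2*pi} t *\<^sub>R cis (of_int (int l + int j - int k) * t)))"
        by (simp only: scaleR_conv_of_real)
    qed
    also have "\<dots> = (\<Sum>j<N. \<Sum>k<N. (e j k / of_real (2 * pi * real N)) * (if int l + int j - int k = 0 then of_real (2*pi) else 0))"
    proof -
      have i: "integrable lborel (\<lambda>t. indicator {0..2*pi} t *\<^sub>R cis (of_int m * t))" for m
        by (rule borel_integrable_compact) (auto intro!: continuous_intros)
      show ?thesis
        by (subst Bochner_Integration.integral_sum, (intro Bochner_Integration.integrable_sum integrable_mult_right i))
           (intro sum.cong refl, subst Bochner_Integration.integral_sum, (intro integrable_mult_right i),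
            simp only: integral_mult_right_zero integral_cis_period)
    qed
    also have "\<dots> = (\<Sum>j<N. \<Sum>k<N. if k = l + j then c l / of_nat N else 0)"
      by (intro sum.cong refl) (use that in \<open>auto simp: e1\<close>)
    also have "\<dots> = (\<Sum>j<N. if l + j < N then c l / of_nat N else 0)"
      by (intro sum.cong refl) (simp add: sum.delta)
    also have "\<dots> = (\<Sum>j<N - l. c l / of_nat N)"
      by (rule sum.mono_neutral_cong_right) auto
    also have "\<dots> = of_real ((real N - real l) / real N) * c l"
      using that by (simp add: of_nat_diff)
    finally show ?thesis .
  qed
  define m where "m N = density lborel (\<lambda>t. ennreal (f (Suc N) t))" for N
  have f1: "integrable lborel (f N)" for N
  proof -
    have "integrable lborel (\<lambda>t. indicator {0..2*pi} t *\<^sub>R p N t)"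
      by (rule borel_integrable_compact) (auto intro!: continuous_on_subset[OF pc])
    then show ?thesis by (simp add: f_def[abs_def])
  qed
  have tot: "(\<integral>t. f N t \<partial>lborel) = 1" if "N > 0" for N
  proof -
    have "complex_of_real (\<integral>t. f N t \<partial>lborel) = (\<integral>t. f N t *\<^sub>R cis (real 0 * t) \<partial>lborel)"
      by (simp add: scaleR_conv_of_real)
    also have "\<dots> = 1" using mom[of N 0] that by (simp add: c0)
    finally show ?thesis by (simp only: of_real_eq_1_iff)
  qed
  have rd: "real_distribution (m N)" for N
  proof -
    have "emeasure (m N) (space (m N)) = (\<integral>\<^sup>+ t. ennreal (f (Suc N) t) \<partial>lborel)"
      by (simp add: m_def emeasure_density)
    also have "\<dots> = 1" using tot[of "Suc N"] f1 f0 by (simp add: nn_integral_eq_integral)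
    finally interpret prob_space "m N" by (rule prob_spaceI)
    show ?thesis by unfold_locales (simp_all add: m_def)
  qed
  \<comment> \<open>Tightness is witnessed by one interval containing [0, 2 pi]: it is open on the
    left, so it starts below 0, and 8 exceeds 2 pi because pi < 4.\<close>
  have "measure (m N) {-1<..8} = 1" for N
  proof -
    interpret real_distribution "m N" by (rule rd)
    have "AE t in m N. t \<in> {-1<..8}"
      unfolding m_def using pi_less_4
      by (subst AE_density) (auto intro!: AE_I2 simp: f_def indicator_def split: if_splits intro: order_trans) 
    then show ?thesis by (simp add: prob_eq_1)
  qed
  then have "tight m" unfolding tight_def using rd
    by (intro conjI allI impI exI[of _ "-1"] exI[of _ 8]) auto
  from tight_imp_convergent_subsubsequence[OF this, of id]
  obtain r M where r: "strict_mono (r :: nat \<Rightarrow> nat)" and M: "real_distribution M" and w: "weak_conv_m (m \<circ> r) M"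
    by (auto simp: strict_mono_def)
  interpret M: real_distribution M by fact
  have cts: "continuous_on UNIV (\<lambda>t. cis (real l * t))" for l by (intro continuous_intros)
  have mm: "(LINT t|m N. cis (real l * t)) = of_real ((real (Suc N) - real l) / real (Suc N)) * c l"
    if "l \<le> Suc N" for l N
  proof -
    have "(\<lambda>t. cis (real l * t)) \<in> borel_measurable borel"
      using cts by (rule borel_measurable_continuous_onI)
    then show ?thesis using mom[of "Suc N" l] that f0 unfolding m_def by (subst integral_density) auto
  qed
  have lim: "(LINT t|M. cis (real l * t)) = c l" for l
  proof (rule LIMSEQ_unique)
    show "(\<lambda>N. LINT t|(m \<circ> r) N. cis (real l * t)) \<longlonglongrightarrow> (LINT t|M. cis (real l * t))"
      by (rule weak_conv_imp_integral_bdd_continuous_conv[OF _ M w, where B = 1])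
         (use rd cts[of l] in \<open>auto simp: continuous_on_eq_continuous_at\<close>)
    have "(\<lambda>N. of_real ((real (Suc N) - real l) / real (Suc N)) * c l) \<longlonglongrightarrow> of_real 1 * c l"
    proof (intro tendsto_intros)
      have "(\<lambda>N. 1 - real l * (1 / real (Suc N))) \<longlonglongrightarrow> 1 - real l * 0"
        by (intro tendsto_intros LIMSEQ_Suc[OF lim_1_over_n])
      then show "(\<lambda>N. (real (Suc N) - real l) / real (Suc N)) \<longlonglongrightarrow> 1"
        by (simp add: diff_divide_distrib)
    qed
    then have "(\<lambda>N. of_real ((real (Suc N) - real l) / real (Suc N)) * c l) \<longlonglongrightarrow> c l" by simp
    from LIMSEQ_subseq_LIMSEQ[OF this r]
    show "(\<lambda>N. LINT t|(m \<circ> r) N. cis (real l * t)) \<longlonglongrightarrow> c l"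
    proof (rule Lim_transform_eventually)
      show "\<forall>\<^sub>F N in sequentially. ((\<lambda>N. of_real ((real (Suc N) - real l) / real (Suc N)) * c l) \<circ> r) N
          = (LINT t|(m \<circ> r) N. cis (real l * t))"
        using eventually_ge_at_top[of l]
      proof eventually_elim
        case (elim N)
        then have "l \<le> Suc (r N)" using seq_suble[OF r, of N] by simp
        then show ?case by (simp add: mm)
      qed
    qed
  qed
  \<comment> \<open>The limit lives on the line; its image under \<open>cis\<close> lives on the
    circle, and \<open>z ^ k\<close> pulls back to \<open>cis (k t)\<close>, whose integral is
    known.\<close>
  let ?\<nu> = "distr M borel cis"
  have cm: "cis \<in> measurable M borel"
    by (simp add: borel_measurable_continuous_onI continuous_on_cis continuous_on_id)
  show ?thesis
  proof (intro exI[of _ ?\<nu>] conjI allI)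
    show "sets ?\<nu> = sets borel" by simp
    show "finite_measure ?\<nu>"
      by (intro prob_space.finite_measure M.prob_space_distr cm)
    have "cis -` (- sphere 0 1) = {}" by auto
    then show "emeasure ?\<nu> (- sphere 0 1) = 0" by (simp add: emeasure_distr[OF cm])
    show "(LINT z|?\<nu>. z ^ k) = c k" for k
      using lim[of k] by (subst integral_distr[OF cm]) (auto simp: Complex.DeMoivre)
  qed
qed

text \<open>Isometry makes the Gram matrix of the orbit of \<open>delta n\<close> a Toeplitz matrix,
  as the moment problem requires.\<close>

lemma whole_CMV_spectral_measure:
  assumes "\<And>n. cmod (\<beta> n) \<le> 1"
  shows "\<exists>\<nu>. is_spectral_measure (whole_CMV \<beta>) (delta n) \<nu>"
proof -
  let ?u = "\<lambda>k. (whole_CMV \<beta> ^^ k) (delta n)"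
  have "ell2_inner (?u j) (?u (j + k)) = ell2_inner (delta n) (?u k)" for j k
    by (simp add: funpow_add whole_CMV_pow_isometry assms finsupp_delta)
  from trig_moment_problem[of ?u, OF _ this] show ?thesis
    unfolding is_spectral_measure_def
    by (simp add: finsupp_whole_CMV_pow finsupp_delta ell2_inner_delta) (simp add: delta_def)
qed

section \<open>Szego recursion for the orthogonal polynomials\<close>

primrec szego_poly :: "(nat \<Rightarrow> complex) \<Rightarrow> nat \<Rightarrow> complex poly" where
  "szego_poly \<alpha> 0 = 1"
| "szego_poly \<alpha> (Suc n) = pCons 0 (szego_poly \<alpha> n) - smult (cnj (\<alpha> n)) (rev_poly (szego_poly \<alpha> n))"

lemma coeff_rev_poly:
  "coeff (rev_poly p) i = (if degree p < i then 0 else cnj (coeff p (degree p - i)))"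
proof -
  have "degree (map_poly cnj p) = degree p" by (rule degree_map_poly) simp
  then show ?thesis by (simp add: rev_poly_def coeff_reflect_poly coeff_map_poly)
qed

lemma degree_rev_poly: "degree (rev_poly p) \<le> degree p"
  by (rule degree_le) (simp add: coeff_rev_poly)

text \<open>The exact degree matters beyond monicity: \<open>rev_poly\<close> reverses at the actual
  degree, so it yields the reversed polynomial of order \<open>n\<close> only if no degree is
  lost.\<close>

lemma szego_poly_monic: "degree (szego_poly \<alpha> n) = n \<and> coeff (szego_poly \<alpha> n) n = 1"
proof (induction n)
  case 0 show ?case by simp
next
  case (Suc n)
  then have c: "coeff (szego_poly \<alpha> (Suc n)) (Suc n) = 1" by (simp add: coeff_rev_poly)
  have "degree (szego_poly \<alpha> (Suc n)) \<le> Suc n"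
    using Suc by (intro degree_le) (auto simp: coeff_rev_poly coeff_pCons coeff_eq_0 split: nat.split)
  moreover have "Suc n \<le> degree (szego_poly \<alpha> (Suc n))" using c by (intro le_degree) simp
  ultimately show ?case using c by (metis le_antisym)
qed

lemmas degree_szego_poly = szego_poly_monic[THEN conjunct1]
  and lead_coeff_szego_poly = szego_poly_monic[THEN conjunct2]

text \<open>Reversal at degree \<open>n + 1\<close> exchanges z times the polynomial with its
  reversed polynomial and conjugates the scalar; the proof compares coefficients, with the two end
  positions apart.\<close>

lemma rev_szego_poly_Suc:
  "rev_poly (szego_poly \<alpha> (Suc n))
     = rev_poly (szego_poly \<alpha> n) - smult (\<alpha> n) (pCons 0 (szego_poly \<alpha> n))"
proof (rule poly_eqI)
  fix i
  let ?p = "szego_poly \<alpha> n"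
  note d = degree_szego_poly[of \<alpha> n] degree_szego_poly[of \<alpha> "Suc n"]
  consider "i = 0" | "1 \<le> i" "i \<le> n" | "i = Suc n" | "i > Suc n" by linarith
  then show "coeff (rev_poly (szego_poly \<alpha> (Suc n))) i
     = coeff (rev_poly ?p - smult (\<alpha> n) (pCons 0 ?p)) i"
  proof cases
    case 1
    then show ?thesis unfolding coeff_rev_poly coeff_diff coeff_smult d
      by (simp add: coeff_rev_poly d)
  next
    case 2
    then obtain k where k: "i = Suc k" "k < n" by (cases i) auto
    then have "Suc n - i = Suc (n - i)" "n - (Suc n - i) = k" "\<not> n < Suc n - i" "i \<le> n" by auto
    then show ?thesis unfolding k(1) unfolding coeff_rev_poly coeff_diff coeff_smult d
      by (simp add: coeff_rev_poly d coeff_pCons split: nat.split)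
  next
    case 3
    then show ?thesis unfolding coeff_rev_poly coeff_diff coeff_smult d
      by (simp add: coeff_rev_poly d)
  next
    case 4
    then show ?thesis unfolding coeff_rev_poly coeff_diff coeff_smult d
      by (simp add: coeff_pCons coeff_eq_0 d split: nat.split)
  qed
qed

text \<open>The half-line matrix is the nonnegative part of a whole-line matrix decoupled by \<open>\<beta> (- 1) = - 1\<close>.\<close>

definition extend_coeffs :: "(nat \<Rightarrow> complex) \<Rightarrow> int \<Rightarrow> complex" where
  "extend_coeffs \<alpha> n = (if n \<ge> 0 then \<alpha> (nat n) else - 1)"

definition extend_seq :: "(nat \<Rightarrow> complex) \<Rightarrow> int \<Rightarrow> complex" where
  "extend_seq u n = (if n \<ge> 0 then u (nat n) else 0)"

lemma whole_CMV_extend: "whole_CMV (extend_coeffs \<alpha>) (extend_seq u) = extend_seq (half_CMV \<alpha> u)"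
proof -
  \<comment> \<open>The vanishing off-diagonal entry cuts the link between the sites -1 and 0, and
    the lower entry \<open>- a = 1\<close> of that block is the initial 1 of
    \<open>M\<close>.\<close>
  have r: "rho (- 1) = 0" by (simp add: rho_def)
  have M: "half_step 1 (extend_coeffs \<alpha>) (extend_seq u) = extend_seq (half_M \<alpha> u)" for u
  proof
    fix j :: int
    show "half_step 1 (extend_coeffs \<alpha>) (extend_seq u) j = extend_seq (half_M \<alpha> u) j"
      by (cases "j \<ge> 0"; cases "j = -1"; cases "j = 0")
         (auto simp: half_step_def extend_seq_def extend_coeffs_def half_M_def Theta1_def Theta2_def r
            nat_add_distrib nat_diff_distrib even_nat_iff)
  qed
  have L: "half_step 0 (extend_coeffs \<alpha>) (extend_seq u) = extend_seq (half_L \<alpha> u)" for u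
  proof
    fix j :: int
    have "even j \<Longrightarrow> j < 0 \<Longrightarrow> j + 1 < 0" by (cases "j = -1") auto
    moreover have "odd j \<Longrightarrow> j \<ge> 0 \<Longrightarrow> j \<ge> 1" by (cases "j = 0") auto
    ultimately show "half_step 0 (extend_coeffs \<alpha>) (extend_seq u) j = extend_seq (half_L \<alpha> u) j"
      by (auto simp: half_step_def extend_seq_def extend_coeffs_def half_L_def Theta1_def Theta2_def
          nat_add_distrib nat_diff_distrib even_nat_iff)
  qed
  show ?thesis by (simp add: whole_CMV_eq half_CMV_def M L)
qed

lemma is_spectral_measure_extend:
  assumes "is_spectral_measure (half_CMV \<alpha>) (delta 0) \<mu>"
  shows "is_spectral_measure (whole_CMV (extend_coeffs \<alpha>)) (delta 0) \<mu>"
proof -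
  have d: "delta 0 = extend_seq (delta 0)" by (rule ext) (auto simp: delta_def extend_seq_def)
  have "(whole_CMV (extend_coeffs \<alpha>) ^^ k) (extend_seq u) = extend_seq ((half_CMV \<alpha> ^^ k) u)" for k u
    by (induction k) (simp_all add: whole_CMV_extend)
  then have "ell2_inner (delta 0) ((whole_CMV (extend_coeffs \<alpha>) ^^ k) (delta 0))
      = ell2_inner (delta 0) ((half_CMV \<alpha> ^^ k) (delta 0))" for k
    unfolding ell2_inner_delta by (subst d) (simp add: extend_seq_def)
  then show ?thesis using assms by (simp add: is_spectral_measure_def)
qed

text \<open>The vector p(E) applied to \<open>delta 0\<close>. This map carries the pairing of
  polynomials in L^2 of the spectral measure to \<open>ell2_inner\<close>, so orthogonality can be
  proved among sequences.\<close>

definition poly_vec :: "int seq_op \<Rightarrow> complex poly \<Rightarrow> int \<Rightarrow> complex" where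
  "poly_vec E p = (\<lambda>i. \<Sum>k\<le>degree p. coeff p k * (E ^^ k) (delta 0) i)"

lemma poly_vec_bound: "degree p \<le> N \<Longrightarrow> poly_vec E p = (\<lambda>i. \<Sum>k\<le>N. coeff p k * (E ^^ k) (delta 0) i)"
  unfolding poly_vec_def by (rule ext, rule sum.mono_neutral_left) (auto simp: coeff_eq_0)

lemma poly_vec_diff_smult:
  "poly_vec E (p - smult c q) = (\<lambda>i. poly_vec E p i - c * poly_vec E q i)"
proof -
  let ?N = "max (degree p) (degree q)"
  have "degree (p - smult c q) \<le> ?N"
    by (intro degree_diff_le order_trans[OF degree_smult_le]) auto
  then show ?thesis
    by (simp add: poly_vec_bound[of _ ?N] sum_subtractf sum_distrib_left algebra_simps)
qed

lemma poly_vec_pCons: 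
  assumes "\<And>A c f. finite A \<Longrightarrow> E (\<lambda>i. \<Sum>a\<in>A. c a * f a i) = (\<lambda>i. \<Sum>a\<in>(A::nat set). c a * E (f a) i)"
  shows "poly_vec E (pCons 0 p) = E (poly_vec E p)"
proof -
  have "degree (pCons 0 p) \<le> Suc (degree p)" by (simp add: degree_pCons_le)
  then have "poly_vec E (pCons 0 p) = (\<lambda>i. \<Sum>k\<le>Suc (degree p). coeff (pCons 0 p) k * (E ^^ k) (delta 0) i)"
    by (rule poly_vec_bound)
  also have "\<dots> = (\<lambda>i. \<Sum>k\<le>degree p. coeff p k * E ((E ^^ k) (delta 0)) i)"
    by (simp only: sum.atMost_Suc_shift) simp
  also have "\<dots> = E (poly_vec E p)" unfolding poly_vec_def by (rule assms[symmetric]) simp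
  finally show ?thesis .
qed

section \<open>Explicit vectors for the Szego polynomials\<close>

locale verblunsky =
  fixes \<alpha> :: "nat \<Rightarrow> complex"
  assumes \<alpha>: "\<And>n. cmod (\<alpha> n) < 1"
begin

abbreviation (input) "\<beta> \<equiv> extend_coeffs \<alpha>"

lemma norm_extend: "cmod (\<beta> n) \<le> 1"
  using \<alpha> by (simp add: extend_coeffs_def less_imp_le)

abbreviation (input) "E \<equiv> whole_CMV \<beta>"
abbreviation (input) "S n \<equiv> half_step (int n) \<beta>"
abbreviation (input) "X \<equiv> poly_vec E"
abbreviation (input) "P n \<equiv> szego_poly \<alpha> n"
abbreviation (input) "Q n \<equiv> rev_poly (szego_poly \<alpha> n)"
abbreviation (input) "e k \<equiv> (E ^^ k) (delta 0)"

text \<open>The first \<open>n\<close> factors of \<open>L M L M \<dots>\<close>: with them \<open>Q n\<close> and \<open>z P n\<close> become multiples of the images of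
  \<open>\<delta> n\<close> under \<open>n\<close> and \<open>n + 1\<close> factors.\<close>

primrec cmv_prod :: "nat \<Rightarrow> int seq_op" where
  "cmv_prod 0 = id"
| "cmv_prod (Suc n) = cmv_prod n \<circ> S n"

lemma cmv_prod_linear:
  "cmv_prod n (\<lambda>i. a * u i + b * v i) = (\<lambda>i. a * cmv_prod n u i + b * cmv_prod n v i)"
  by (induction n arbitrary: u v) (simp_all add: half_step_add half_step_scale)

lemma finsupp_cmv_prod: "finsupp u \<Longrightarrow> finsupp (cmv_prod n u)"
  by (induction n arbitrary: u) (simp_all add: finsupp_half_step)

lemma cmv_prod_isometry:
  "finsupp u \<Longrightarrow> ell2_inner (cmv_prod n u) (cmv_prod n v) = ell2_inner u v"
  by (induction n arbitrary: u v) (simp_all add: finsupp_half_step half_step_isometry norm_extend)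

text \<open>Both sides are the alternating product of \<open>n + 2\<close> factors that begins with
  parity 0.\<close>

lemma whole_CMV_cmv_prod: "E (cmv_prod n u) = cmv_prod n (S n (S (Suc n) u))"
proof (induction n arbitrary: u)
  case 0 show ?case by (simp add: whole_CMV_eq)
next
  case (Suc n)
  have "half_step (int (Suc (Suc n))) = half_step (int n)" by (rule half_step_cong) simp
  then show ?case by (simp add: Suc.IH del: of_nat_Suc)
qed

lemma half_step_delta:
  "S n (delta (int n)) = (\<lambda>i. cnj (\<alpha> n) * delta (int n) i + rho (\<alpha> n) * delta (int (Suc n)) i)"
  "S n (delta (int (Suc n))) = (\<lambda>i. rho (\<alpha> n) * delta (int n) i + (- \<alpha> n) * delta (int (Suc n)) i)"
proof -
  have p: "even n \<longleftrightarrow> odd i" if "i + 1 = int n" for i :: int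
    using that by presburger
  have r: "rho (- 1) = 0" by (simp add: rho_def)
  show "S n (delta (int n)) = (\<lambda>i. cnj (\<alpha> n) * delta (int n) i + rho (\<alpha> n) * delta (int (Suc n)) i)"
    by (rule ext, auto simp: half_step_def Theta1_def Theta2_def delta_def extend_coeffs_def r p)
  show "S n (delta (int (Suc n))) = (\<lambda>i. rho (\<alpha> n) * delta (int n) i + (- \<alpha> n) * delta (int (Suc n)) i)"
    by (rule ext, auto simp: half_step_def Theta1_def Theta2_def delta_def extend_coeffs_def)
qed

text \<open>One block, written in the shape of the two Szego recursions: up to
  \<open>cmv_prod n\<close> and a scalar, \<open>Q n\<close> is \<open>delta n\<close>, z
  \<open>P n\<close> is its image under \<open>S n\<close>, and the next pair sits at
  \<open>delta (n + 1)\<close>.\<close>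

lemma half_step_delta':
  "(\<lambda>i. S n (delta (int n)) i + (- cnj (\<alpha> n)) * delta (int n) i) = (\<lambda>i. rho (\<alpha> n) * delta (int (Suc n)) i)"
  "(\<lambda>i. delta (int n) i + (- \<alpha> n) * S n (delta (int n)) i) = (\<lambda>i. rho (\<alpha> n) * S n (delta (int (Suc n))) i)"
proof -
  show "(\<lambda>i. S n (delta (int n)) i + (- cnj (\<alpha> n)) * delta (int n) i) = (\<lambda>i. rho (\<alpha> n) * delta (int (Suc n)) i)"
    by (simp add: half_step_delta)
  have r: "rho (\<alpha> n) * rho (\<alpha> n) = 1 - \<alpha> n * cnj (\<alpha> n)"
    using rho_square[of "\<alpha> n"] \<alpha>[of n] by simp
  have "x + - \<alpha> n * (cnj (\<alpha> n) * x + rho (\<alpha> n) * y) = rho (\<alpha> n) * (rho (\<alpha> n) * x + - \<alpha> n * y)" for x y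
    unfolding distrib_left mult.assoc[symmetric] r by (simp add: algebra_simps)
  then show "(\<lambda>i. delta (int n) i + (- \<alpha> n) * S n (delta (int n)) i) = (\<lambda>i. rho (\<alpha> n) * S n (delta (int (Suc n))) i)"
    unfolding half_step_delta by (rule ext)
qed

lemma cmv_prod_scale: "cmv_prod n (\<lambda>i. a * u i) = (\<lambda>i. a * cmv_prod n u i)"
  using cmv_prod_linear[of n a u 0 u] by simp

lemma cmv_prod_add: "cmv_prod n (\<lambda>i. u i + b * v i) = (\<lambda>i. cmv_prod n u i + b * cmv_prod n v i)"
  using cmv_prod_linear[of n 1 u b v] by simp

text \<open>The norm of the monic polynomial of degree \<open>n\<close>, hence the reciprocal of the
  leading coefficient of the orthonormal one, for which this letter is also common.\<close>

definition kappa :: "nat \<Rightarrow> complex" where "kappa n = (\<Prod>j<n. rho (\<alpha> j))"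

lemma kappa_Suc: "kappa (Suc n) = kappa n * rho (\<alpha> n)" by (simp add: kappa_def)

lemma kappa_nz: "kappa n \<noteq> 0"
proof -
  have "rho (\<alpha> j) \<noteq> 0" for j
  proof -
    have "(cmod (\<alpha> j))\<^sup>2 < 1" using \<alpha>[of j] by (simp add: abs_square_less_1)
    then show ?thesis by (simp add: rho_def)
  qed
  then show ?thesis by (simp add: kappa_def)
qed

lemma poly_vec_P_Suc: "X (P (Suc n)) = (\<lambda>i. E (X (P n)) i - cnj (\<alpha> n) * X (Q n) i)"
  by (simp add: poly_vec_diff_smult poly_vec_pCons[OF whole_CMV_linear])

lemma poly_vec_Q_Suc: "X (Q (Suc n)) = (\<lambda>i. X (Q n) i - \<alpha> n * E (X (P n)) i)"
  unfolding rev_szego_poly_Suc poly_vec_diff_smult poly_vec_pCons[OF whole_CMV_linear] ..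

lemma poly_vec_P_aux:
  assumes "X (Q n) = (\<lambda>i. kappa n * cmv_prod n (delta (int n)) i)"
    "E (X (P n)) = (\<lambda>i. kappa n * cmv_prod (Suc n) (delta (int n)) i)"
  shows "X (P (Suc n)) = (\<lambda>i. kappa (Suc n) * cmv_prod n (delta (int (Suc n))) i)"
proof -
  have "X (P (Suc n)) = (\<lambda>i. kappa n * cmv_prod n (\<lambda>i. S n (delta (int n)) i + (- cnj (\<alpha> n)) * delta (int n) i) i)"
    unfolding poly_vec_P_Suc assms cmv_prod_add by (simp add: algebra_simps)
  then show ?thesis unfolding half_step_delta' cmv_prod_scale kappa_Suc by (simp add: mult.assoc)
qed

text \<open>The induction couples \<open>Q n\<close> with z \<open>P n\<close> and not with
  \<open>P n\<close>: the vector of \<open>P n\<close> needs one factor less than that of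
  \<open>Q n\<close>, which makes no sense at \<open>n = 0\<close>.\<close>

lemma poly_vec_QP:
  "X (Q n) = (\<lambda>i. kappa n * cmv_prod n (delta (int n)) i) \<and>
   E (X (P n)) = (\<lambda>i. kappa n * cmv_prod (Suc n) (delta (int n)) i)"
proof (induction n)
  case 0
  \<comment> \<open>\<open>M\<close> fixes \<open>delta 0\<close> because the coefficient at -1 is
    -1.\<close>
  have "half_step 1 \<beta> (delta 0) = delta 0"
    by (rule ext) (auto simp: half_step_def Theta1_def Theta2_def delta_def extend_coeffs_def rho_def)
  moreover have "rev_poly 1 = 1" by (simp add: rev_poly_def)
  moreover have "X 1 = delta 0" by (simp add: poly_vec_def)
  moreover have "E (delta 0) = half_step 0 \<beta> (half_step 1 \<beta> (delta 0))" by (simp add: whole_CMV_eq)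
  ultimately show ?case by (simp add: kappa_def)
next
  case (Suc n)
  note Suc = Suc[THEN conjunct1] Suc[THEN conjunct2]
  have "X (Q (Suc n)) = (\<lambda>i. kappa n * cmv_prod n (\<lambda>i. delta (int n) i + (- \<alpha> n) * S n (delta (int n)) i) i)"
    unfolding poly_vec_Q_Suc Suc cmv_prod_add by (simp add: algebra_simps)
  also have "\<dots> = (\<lambda>i. kappa (Suc n) * cmv_prod (Suc n) (delta (int (Suc n))) i)"
    unfolding half_step_delta' cmv_prod_scale kappa_Suc by (simp add: mult.assoc)
  finally have 1: "X (Q (Suc n)) = (\<lambda>i. kappa (Suc n) * cmv_prod (Suc n) (delta (int (Suc n))) i)" .
  have "E (X (P (Suc n))) = (\<lambda>i. kappa (Suc n) * E (cmv_prod n (delta (int (Suc n)))) i)"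
    unfolding poly_vec_P_aux[OF Suc] by (simp add: whole_CMV_eq half_step_scale)
  also have "\<dots> = (\<lambda>i. kappa (Suc n) * cmv_prod (Suc (Suc n)) (delta (int (Suc n))) i)"
    by (simp only: whole_CMV_cmv_prod) simp
  finally show ?case using 1 by blast
qed

lemmas poly_vec_Q = poly_vec_QP[THEN conjunct1]
  and whole_CMV_poly_vec_P = poly_vec_QP[THEN conjunct2]

lemmas poly_vec_P = poly_vec_P_aux[OF poly_vec_Q whole_CMV_poly_vec_P]

lemma finsupp_e: "finsupp (e k)"
  by (simp add: finsupp_whole_CMV_pow finsupp_delta)

lemma finsupp_X: "finsupp (X p)"
  unfolding poly_vec_def by (rule finsupp_sum) (simp_all add: finsupp_e)

lemma ell2_inner_X_left: "finsupp v \<Longrightarrow> ell2_inner (X p) v = (\<Sum>k\<le>degree p. cnj (coeff p k) * ell2_inner (e k) v)"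
  unfolding poly_vec_def by (rule ell2_inner_sum_left)

lemma ell2_inner_X_right: "finsupp v \<Longrightarrow> ell2_inner v (X p) = (\<Sum>k\<le>degree p. coeff p k * ell2_inner v (e k))"
  unfolding poly_vec_def by (rule ell2_inner_sum_right)

text \<open>Orthogonality to \<open>z\<^sup>0\<close> resp. \<open>z\<^sup>n\<^sup>+\<^sup>1\<close>, which the recursion does not give directly, comes from
  \<open>Q n = 1 + \<dots>\<close>, \<open>z P n = \<dots> + z\<^sup>n\<^sup>+\<^sup>1\<close> and the explicit vectors.\<close>

lemma szego_orthogonal:
  "(\<forall>j<n. ell2_inner (e j) (X (P n)) = 0) \<and> (\<forall>j\<in>{1..n}. ell2_inner (e j) (X (Q n)) = 0)"
proof (induction n)
  case 0 show ?case by simp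
next
  case (Suc n)
  have shift: "ell2_inner (e (Suc j)) (E (X p)) = ell2_inner (e j) (X p)" for j p
    by (simp add: whole_CMV_isometry norm_extend finsupp_e)
  have P: "ell2_inner (e j) (X (P (Suc n))) = 0" if j: "1 \<le> j" "j \<le> n" for j
  proof -
    obtain k where "j = Suc k" "k < n" using j by (cases j) auto
    then show ?thesis using Suc j
      by (simp add: poly_vec_P_Suc ell2_inner_diff_right finsupp_e shift del: szego_poly.simps funpow.simps)
  qed
  have Q: "ell2_inner (e j) (X (Q (Suc n))) = 0" if j: "1 \<le> j" "j \<le> n" for j
  proof -
    obtain k where "j = Suc k" "k < n" using j by (cases j) auto
    then show ?thesis using Suc j
      by (simp add: poly_vec_Q_Suc ell2_inner_diff_right finsupp_e shift del: szego_poly.simps funpow.simps)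
  qed
  \<comment> \<open>Up to scalars these are images of \<open>delta n\<close> and
    \<open>delta (n + 1)\<close> under the same isometry \<open>cmv_prod n\<close>; the later pair
    uses \<open>cmv_prod (n + 1)\<close> in the same way.\<close>
  have "ell2_inner (X (Q n)) (X (P (Suc n))) = 0"
    unfolding poly_vec_Q poly_vec_P
    by (simp add: ell2_inner_scale finsupp_cmv_prod finsupp_delta cmv_prod_isometry ell2_inner_delta_delta)
  moreover have "ell2_inner (X (Q n)) (X (P (Suc n))) = ell2_inner (e 0) (X (P (Suc n)))"
  proof -
    have "ell2_inner (X (Q n)) (X (P (Suc n)))
        = (\<Sum>k\<le>degree (Q n). cnj (coeff (Q n) k) * ell2_inner (e k) (X (P (Suc n))))"
      by (rule ell2_inner_X_left[OF finsupp_X])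
    also have "\<dots> = (\<Sum>k\<in>{0}. cnj (coeff (Q n) k) * ell2_inner (e k) (X (P (Suc n))))"
      using P degree_rev_poly[of "P n"]
      by (intro sum.mono_neutral_right) (auto simp: degree_szego_poly)
    also have "\<dots> = ell2_inner (e 0) (X (P (Suc n)))"
      by (simp add: coeff_rev_poly degree_szego_poly lead_coeff_szego_poly)
    finally show ?thesis .
  qed
  ultimately have P0: "ell2_inner (e 0) (X (P (Suc n))) = 0" by simp
  have "ell2_inner (E (X (P n))) (X (Q (Suc n))) = 0"
    unfolding poly_vec_Q whole_CMV_poly_vec_P
    by (simp only: ell2_inner_scale finsupp_cmv_prod finsupp_delta cmv_prod_isometry ell2_inner_delta_delta) simp
  moreover have "ell2_inner (E (X (P n))) (X (Q (Suc n))) = ell2_inner (e (Suc n)) (X (Q (Suc n)))"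
  proof -
    have "E (X (P n)) = (\<lambda>i. \<Sum>k\<le>n. coeff (P n) k * e (Suc k) i)"
      unfolding poly_vec_def degree_szego_poly whole_CMV_linear by simp
    then have "ell2_inner (E (X (P n))) (X (Q (Suc n)))
        = (\<Sum>k\<le>n. cnj (coeff (P n) k) * ell2_inner (e (Suc k)) (X (Q (Suc n))))"
      by (simp only: ell2_inner_sum_left[OF finsupp_X])
    also have "\<dots> = (\<Sum>k\<in>{n}. cnj (coeff (P n) k) * ell2_inner (e (Suc k)) (X (Q (Suc n))))"
    proof (intro sum.mono_neutral_right ballI)
      fix k assume "k \<in> {..n} - {n}"
      then show "cnj (coeff (P n) k) * ell2_inner (e (Suc k)) (X (Q (Suc n))) = 0"
        using Q[of "Suc k"] by simp
    qed auto
    also have "\<dots> = ell2_inner (e (Suc n)) (X (Q (Suc n)))"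
      by (simp add: lead_coeff_szego_poly)
    finally show ?thesis .
  qed
  ultimately have Qn: "ell2_inner (e (Suc n)) (X (Q (Suc n))) = 0" by simp
  show ?case
  proof (intro conjI allI impI ballI)
    fix j assume "j < Suc n"
    then show "ell2_inner (e j) (X (P (Suc n))) = 0" using P[of j] P0 by (cases "j = 0") auto
  next
    fix j assume "j \<in> {1..Suc n}"
    then show "ell2_inner (e j) (X (Q (Suc n))) = 0" using Q[of j] Qn by (cases "j = Suc n") auto
  qed
qed

section \<open>Identification with the orthogonal polynomials of the measure\<close>

lemma szego_poly_norm_nz: "ell2_inner (X (P n)) (X (P n)) \<noteq> 0"
proof -
  have "ell2_inner (X (P n)) (X (P n)) = ell2_inner (E (X (P n))) (E (X (P n)))"
    by (simp add: whole_CMV_isometry norm_extend finsupp_X)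
  also have "\<dots> = cnj (kappa n) * kappa n"
    unfolding whole_CMV_poly_vec_P
    by (simp only: ell2_inner_scale finsupp_cmv_prod finsupp_delta cmv_prod_isometry ell2_inner_delta_delta) simp
  finally show ?thesis using kappa_nz by simp
qed

text \<open>A nonzero difference has some degree \<open>m < n\<close> and is orthogonal to all lower
  powers, hence to \<open>P m\<close>; but pairing with \<open>P m\<close> returns its leading
  coefficient times a nonzero number.\<close>

lemma szego_poly_unique:
  assumes p: "degree p = n" "coeff p n = 1" "\<And>j. j < n \<Longrightarrow> ell2_inner (e j) (X p) = 0"
  shows "p = P n"
proof (rule ccontr)
  assume "p \<noteq> P n"
  define d where "d = p - P n"
  have d0: "d \<noteq> 0" using \<open>p \<noteq> P n\<close> by (simp add: d_def)
  define m where "m = degree d"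
  have "degree d \<le> n" unfolding d_def by (intro degree_diff_le) (simp_all add: p degree_szego_poly)
  moreover have "coeff d n = 0" by (simp add: d_def p lead_coeff_szego_poly)
  ultimately have "m < n" unfolding m_def using d0 by (metis le_neq_implies_less leading_coeff_0_iff)
  have "X d = (\<lambda>i. X p i - 1 * X (P n) i)" using poly_vec_diff_smult[of E p 1 "P n"] by (simp add: d_def)
  then have ed: "ell2_inner (e j) (X d) = 0" if "j < n" for j
    using that p(3) szego_orthogonal[of n] by (simp add: ell2_inner_diff_right[where c = 1, simplified] finsupp_e)
  have "ell2_inner (X (P m)) (X d) = 0"
    unfolding ell2_inner_X_left[OF finsupp_X] degree_szego_poly
    using ed \<open>m < n\<close> by (intro sum.neutral) auto
  moreover have Pe: "ell2_inner (X (P m)) (X q) = coeff q m * ell2_inner (X (P m)) (e m)" if "degree q = m" for q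
  proof -
    have "ell2_inner (X (P m)) (e k) = 0" if "k < m" for k
      using szego_orthogonal[of m] that by (subst ell2_inner_commute) simp
    then have "(\<Sum>k\<le>m. coeff q k * ell2_inner (X (P m)) (e k)) = (\<Sum>k\<in>{m}. coeff q k * ell2_inner (X (P m)) (e k))"
      by (intro sum.mono_neutral_right) auto
    then show ?thesis by (simp add: ell2_inner_X_right[OF finsupp_X] that)
  qed
  ultimately have "coeff d m * ell2_inner (X (P m)) (e m) = 0" by (simp add: m_def)
  moreover have "ell2_inner (X (P m)) (e m) \<noteq> 0"
    using szego_poly_norm_nz[of m] Pe[of "P m"] by (simp add: degree_szego_poly lead_coeff_szego_poly)
  moreover have "coeff d m \<noteq> 0" using d0 by (simp add: m_def)
  ultimately show False by simp
qed

text \<open>Only moments with nonnegative exponent are given. On the circle the integrand is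
  \<open>z ^ (k - j)\<close> when \<open>j \<le> k\<close>, which isometry matches with the vectors;
  the remaining case follows by conjugation.\<close>

lemma spectral_integral:
  assumes "is_spectral_measure E (delta 0) \<mu>"
  shows "(LINT z|\<mu>. cnj (z ^ j) * poly p z) = ell2_inner (e j) (X p)"
proof -
  from assms have sets: "sets \<mu> = sets borel" and fin: "finite_measure \<mu>"
    and null: "emeasure \<mu> (- sphere 0 1) = 0"
    and mom: "\<And>k::nat. (LINT z|\<mu>. z ^ k) = ell2_inner (delta 0) (e k)"
    by (auto simp: is_spectral_measure_def)
  interpret finite_measure \<mu> by (rule fin)
  have AE1: "AE z in \<mu>. cmod z = 1"
    by (rule AE_I[OF _ null]) (auto simp: sets)
  have meas: "f \<in> borel_measurable \<mu>" if "continuous_on UNIV f" for f :: "complex \<Rightarrow> complex"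
    using borel_measurable_continuous_onI[OF that] measurable_cong_sets[OF sets refl] by blast
  have int: "integrable \<mu> (\<lambda>z. cnj (z ^ j) * z ^ k)" for k
  proof (rule integrable_const_bound[where B = 1])
    show "AE z in \<mu>. cmod (cnj (z ^ j) * z ^ k) \<le> 1"
      using AE1 by eventually_elim (simp add: norm_mult norm_power)
  qed (intro meas continuous_intros)
  have mixed: "(LINT z|\<mu>. cnj (z ^ j) * z ^ k) = ell2_inner (e j) (e k)" if "j \<le> k" for j k
  proof -
    have "(LINT z|\<mu>. cnj (z ^ j) * z ^ k) = (LINT z|\<mu>. z ^ (k - j))"
    proof (rule integral_cong_AE)
      show "AE z in \<mu>. cnj (z ^ j) * z ^ k = z ^ (k - j)"
        using AE1
      proof eventually_elim
        case (elim z)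
        then have "cnj z * z = 1" using complex_norm_square[of z] by (simp add: mult.commute)
        then have "cnj (z ^ j) * z ^ j = 1" by (metis complex_cnj_power power_mult_distrib power_one)
        moreover have "z ^ k = z ^ j * z ^ (k - j)" using that by (simp add: power_add[symmetric])
        ultimately show ?case by (simp add: mult.assoc[symmetric])
      qed
    qed (intro meas continuous_intros)+
    also have "\<dots> = ell2_inner (e j) ((E ^^ j) (e (k - j)))"
      by (simp add: mom whole_CMV_pow_isometry norm_extend finsupp_delta)
    also have "(E ^^ j) (e (k - j)) = e k"
      using that by (simp add: funpow_add[symmetric, THEN fun_cong, unfolded o_def])
    finally show ?thesis .
  qed
  have mixed': "(LINT z|\<mu>. cnj (z ^ j) * z ^ k) = ell2_inner (e j) (e k)" for k
  proof (cases "j \<le> k")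
    case False
    have "(LINT z|\<mu>. cnj (z ^ j) * z ^ k) = (LINT z|\<mu>. cnj (cnj (z ^ k) * z ^ j))"
      by (simp add: mult.commute)
    also have "\<dots> = cnj (LINT z|\<mu>. cnj (z ^ k) * z ^ j)" by (rule Bochner_Integration.integral_cnj)
    also have "\<dots> = cnj (ell2_inner (e k) (e j))"
      using mixed[of k j] False by simp
    finally show ?thesis by (simp only: ell2_inner_commute[symmetric])
  qed (rule mixed)
  have "(LINT z|\<mu>. cnj (z ^ j) * poly p z) = (LINT z|\<mu>. (\<Sum>k\<le>degree p. coeff p k * (cnj (z ^ j) * z ^ k)))"
    by (simp add: poly_altdef sum_distrib_left mult_ac)
  also have "\<dots> = (\<Sum>k\<le>degree p. coeff p k * ell2_inner (e j) (e k))"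
    by (subst Bochner_Integration.integral_sum) (simp_all add: int mixed' del: complex_cnj_power)
  finally show ?thesis by (simp add: ell2_inner_X_right[OF finsupp_e])
qed

end

text \<open>Here the entries of the matrix become the Verblunsky coefficients of its spectral
  measure.\<close>

lemma monic_OP_eq_szego_poly:
  assumes "\<And>n. cmod (\<alpha> n) < 1" "is_spectral_measure (half_CMV \<alpha>) (delta 0) \<mu>" "is_monic_OP \<mu> n p"
  shows "p = szego_poly \<alpha> n"
proof -
  interpret verblunsky \<alpha> by unfold_locales (rule assms(1))
  note int = spectral_integral[OF is_spectral_measure_extend[OF assms(2)]]
  show ?thesis
  proof (rule szego_poly_unique)
    show "degree p = n" "coeff p n = 1" using assms(3) by (auto simp: is_monic_OP_def)
    show "ell2_inner ((whole_CMV (extend_coeffs \<alpha>) ^^ j) (delta 0)) (poly_vec (whole_CMV (extend_coeffs \<alpha>)) p) = 0"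
      if "j < n" for j
      using assms(3) that int by (simp add: is_monic_OP_def)
  qed
qed

section \<open>Dynamics of the quotients and right limits\<close>

text \<open>Multiplication by \<open>z\<close> followed by a Moebius map of the disc, as in an
  inverse Schur algorithm. For |a| = 1 it degenerates to the constant \<open>- cnj a\<close>, a case
  that right limits do produce.\<close>

definition szego_step :: "complex \<Rightarrow> complex \<Rightarrow> complex \<Rightarrow> complex" where
  "szego_step z a w = (z * w - cnj a) / (1 - a * (z * w))"

definition szego_orbit :: "complex \<Rightarrow> (int \<Rightarrow> complex) \<Rightarrow> (int \<Rightarrow> complex) \<Rightarrow> bool" where
  "szego_orbit z \<beta> w \<longleftrightarrow> (\<forall>n. cmod (w n) \<le> 1 \<and> w (n + 1) = szego_step z (\<beta> n) (w n))"

lemma szego_denom: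
  assumes "cmod z < 1" "cmod a \<le> 1" "cmod w \<le> 1"
  shows "cmod (z * w) < 1" "1 - a * (z * w) \<noteq> 0"
proof -
  show *: "cmod (z * w) < 1"
    using assms by (simp add: norm_mult) (meson le_less_trans mult_left_le norm_ge_zero)
  then have "cmod (a * (z * w)) < 1"
    using assms(2) by (simp add: norm_mult[of a]) (meson le_less_trans mult_left_le_one_le norm_ge_zero)
  then show "1 - a * (z * w) \<noteq> 0" by auto
qed

lemma szego_step_norm:
  assumes "1 - a * y \<noteq> 0"
  shows "1 - (cmod ((y - cnj a) / (1 - a * y)))\<^sup>2
       = (1 - (cmod a)\<^sup>2) * (1 - (cmod y)\<^sup>2) / (cmod (1 - a * y))\<^sup>2"
proof -
  have "complex_of_real ((cmod (1 - a * y))\<^sup>2 - (cmod (y - cnj a))\<^sup>2)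
      = of_real ((1 - (cmod a)\<^sup>2) * (1 - (cmod y)\<^sup>2))"
    by (simp only: of_real_diff of_real_mult complex_norm_square of_real_1) (simp add: algebra_simps)
  then have "(cmod (1 - a * y))\<^sup>2 - (cmod (y - cnj a))\<^sup>2 = (1 - (cmod a)\<^sup>2) * (1 - (cmod y)\<^sup>2)"
    by (simp only: of_real_eq_iff)
  then show ?thesis using assms
    by (simp add: norm_divide power_divide field_simps)
qed

lemma szego_step_diff:
  assumes "1 - a * y \<noteq> 0" "1 - a * y' \<noteq> 0"
  shows "(y - cnj a) / (1 - a * y) - (y' - cnj a) / (1 - a * y')
       = of_real (1 - (cmod a)\<^sup>2) * (y - y') / ((1 - a * y) * (1 - a * y'))"
  using assms by (simp only: of_real_diff complex_norm_square of_real_1) (simp add: divide_simps, simp add: algebra_simps)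

lemma norm_szego_step:
  assumes "cmod z < 1" "cmod a \<le> 1" "cmod w \<le> 1"
  shows "cmod (szego_step z a w) \<le> 1"
proof -
  note d = szego_denom[OF assms]
  have "0 \<le> (1 - (cmod a)\<^sup>2) * (1 - (cmod (z * w))\<^sup>2) / (cmod (1 - a * (z * w)))\<^sup>2"
    using d(1) assms(2) by (intro divide_nonneg_nonneg mult_nonneg_nonneg) (auto intro: power_le_one)
  then have "(cmod (szego_step z a w))\<^sup>2 \<le> 1"
    unfolding szego_step_def szego_step_norm[OF d(2), symmetric] by simp
  then show ?thesis by (simp add: abs_square_le_1)
qed

text \<open>The weight \<open>(1 - \<bar>z w\<bar>\<^sup>2) (1 - \<bar>z w'\<bar>\<^sup>2)\<close> makes this the invariance of the pseudohyperbolic metric under disc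
  automorphisms, in a form that survives \<open>\<bar>w\<bar> = 1\<close>.\<close>

lemma szego_contraction:
  fixes w w' a :: "nat \<Rightarrow> complex"
  assumes z: "cmod z < 1" and a: "\<And>n. cmod (a n) \<le> 1"
    and w: "\<And>n. cmod (w n) \<le> 1" "\<And>n. w (Suc n) = szego_step z (a n) (w n)"
    and w': "\<And>n. cmod (w' n) \<le> 1" "\<And>n. w' (Suc n) = szego_step z (a n) (w' n)"
  shows "(cmod (w n - w' n))\<^sup>2 \<le> 4 / (1 - (cmod z)\<^sup>2)\<^sup>2 * ((cmod z)\<^sup>2) ^ n"
proof -
  \<comment> \<open>Initially the squared distance is at most 4 and each of the two weights is at
    least 1 - |z|^2.\<close>
  define K where "K = 4 / (1 - (cmod z)\<^sup>2)\<^sup>2"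
  have z2: "(cmod z)\<^sup>2 < 1" using z by (simp add: power_less_one_iff abs_square_less_1)
  have K0: "K \<ge> 0" by (simp add: K_def)
  define A where "A v = 1 - (cmod (z * v))\<^sup>2" for v
  have A1: "A v \<le> 1" for v by (simp add: A_def)
  have A0: "1 - (cmod z)\<^sup>2 \<le> A v" if "cmod v \<le> 1" for v
    using that by (simp add: A_def norm_mult power_mult_distrib mult_left_le power_le_one)
  have A0': "0 \<le> A v" if "cmod v \<le> 1" for v using A0[OF that] z2 by linarith
  \<comment> \<open>The step produces the defects 1 - |v|^2 of the new points; this bound turns them
    back into the weights that the next step consumes.\<close>
  have Av: "1 - (cmod v)\<^sup>2 \<le> A v" for v
    using z2 by (simp add: A_def norm_mult power_mult_distrib mult_left_le_one_le)
  have B0: "0 \<le> 1 - (cmod v)\<^sup>2" if "cmod v \<le> 1" for v using that by (simp add: power_le_one)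
  have P0: "0 \<le> K * ((cmod z)\<^sup>2) ^ n" for n using K0 by simp
  have "(cmod (w n - w' n))\<^sup>2 \<le> K * ((cmod z)\<^sup>2) ^ n * (A (w n) * A (w' n))"
  proof (induction n)
    case 0
    have "cmod (w 0 - w' 0) \<le> 2" using norm_triangle_ineq4[of "w 0" "w' 0"] w(1)[of 0] w'(1)[of 0] by linarith
    then have "(cmod (w 0 - w' 0))\<^sup>2 \<le> 2\<^sup>2" by (intro power_mono) auto
    also have "\<dots> = K * ((1 - (cmod z)\<^sup>2) * (1 - (cmod z)\<^sup>2))"
      using z2 by (simp add: K_def power2_eq_square)
    also have "\<dots> \<le> K * (A (w 0) * A (w' 0))"
      using z2 by (intro mult_left_mono mult_mono A0 A0' w w' K0) simp
    finally show ?case by simp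
  next
    case (Suc n)
    note d = szego_denom(2)[OF z a w(1), of n n] and d' = szego_denom(2)[OF z a w'(1), of n n]
    define r where "r = 1 - (cmod (a n))\<^sup>2"
    have r0: "0 \<le> r" using a by (simp add: r_def power_le_one)
    define q where "q = (cmod (1 - a n * (z * w n)))\<^sup>2 * (cmod (1 - a n * (z * w' n)))\<^sup>2"
    have q0: "q > 0" using d d' by (simp add: q_def)
    have "w (Suc n) - w' (Suc n) = of_real r * (z * w n - z * w' n) / ((1 - a n * (z * w n)) * (1 - a n * (z * w' n)))"
      unfolding w(2) w'(2) szego_step_def r_def by (rule szego_step_diff[OF d d'])
    also have "z * w n - z * w' n = z * (w n - w' n)" by (simp add: right_diff_distrib)
    finally have "(cmod (w (Suc n) - w' (Suc n)))\<^sup>2 = r\<^sup>2 * (cmod z)\<^sup>2 * (cmod (w n - w' n))\<^sup>2 / q"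
      using r0 by (simp add: norm_mult norm_divide power_mult_distrib power_divide q_def)
    also have "\<dots> \<le> r\<^sup>2 * (cmod z)\<^sup>2 * (K * ((cmod z)\<^sup>2) ^ n * (A (w n) * A (w' n))) / q"
      using q0 by (intro divide_right_mono mult_left_mono Suc.IH) simp_all
    also have "\<dots> = K * ((cmod z)\<^sup>2) ^ Suc n * ((1 - (cmod (w (Suc n)))\<^sup>2) * (1 - (cmod (w' (Suc n)))\<^sup>2))"
    proof -
      have alg: "r\<^sup>2 * Z * (K * P * (a * a')) / (d1 * d2) = K * (Z * P) * ((r * a / d1) * (r * a' / d2))"
        for Z P a a' d1 d2 :: real by (simp add: power2_eq_square)
      show ?thesis
        unfolding w(2) w'(2) szego_step_def szego_step_norm[OF d] szego_step_norm[OF d'] r_def[symmetric]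
          A_def[symmetric] q_def power_Suc by (rule alg)
    qed
    also have "\<dots> \<le> K * ((cmod z)\<^sup>2) ^ Suc n * (A (w (Suc n)) * A (w' (Suc n)))"
      by (intro mult_left_mono mult_mono Av A0' B0 P0 w(1) w'(1))
    finally show ?case .
  qed
  also have "\<dots> \<le> K * ((cmod z)\<^sup>2) ^ n * (1 * 1)"
    by (intro mult_left_mono mult_mono A1 A0' P0 w(1) w'(1)) simp
  finally show ?thesis by (simp add: K_def)
qed

text \<open>A two-sided orbit has room for arbitrarily many contraction steps: started at
  \<open>n - m\<close>, the bound at \<open>n\<close> decays in \<open>m\<close> with a constant
  independent of \<open>m\<close>.\<close>

lemma szego_orbit_unique:
  assumes z: "cmod z < 1" and b: "\<And>n. cmod (\<beta> n) \<le> 1"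
    and w: "szego_orbit z \<beta> w" and w': "szego_orbit z \<beta> w'"
  shows "w = w'"
proof
  fix n
  have "(cmod (w n - w' n))\<^sup>2 \<le> 4 / (1 - (cmod z)\<^sup>2)\<^sup>2 * ((cmod z)\<^sup>2) ^ m" for m
  proof -
    have S: "n - int m + int (Suc k) = (n - int m + int k) + 1" for k by simp
    have sw: "v (n - int m + int (Suc k)) = szego_step z (\<beta> (n - int m + int k)) (v (n - int m + int k))"
      if "szego_orbit z \<beta> v" for v k
      unfolding S using that by (simp add: szego_orbit_def)
    have "(cmod (w (n - int m + int m) - w' (n - int m + int m)))\<^sup>2
        \<le> 4 / (1 - (cmod z)\<^sup>2)\<^sup>2 * ((cmod z)\<^sup>2) ^ m"
      by (rule szego_contraction[OF z, where a = "\<lambda>k. \<beta> (n - int m + int k)"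
              and w = "\<lambda>k. w (n - int m + int k)" and w' = "\<lambda>k. w' (n - int m + int k)"])
         (use b w w' sw[OF w] sw[OF w'] in \<open>simp_all add: szego_orbit_def del: of_nat_Suc\<close>)
    then show ?thesis by simp
  qed
  moreover have "(\<lambda>m. 4 / (1 - (cmod z)\<^sup>2)\<^sup>2 * ((cmod z)\<^sup>2) ^ m) \<longlonglongrightarrow> 4 / (1 - (cmod z)\<^sup>2)\<^sup>2 * 0"
    using z by (intro tendsto_intros LIMSEQ_power_zero) (simp add: abs_square_less_1)
  ultimately have "(cmod (w n - w' n))\<^sup>2 \<le> 4 / (1 - (cmod z)\<^sup>2)\<^sup>2 * 0"
    by (intro LIMSEQ_le_const) auto
  then show "w n = w' n" by simp
qed

text \<open>Rotating the coefficients by \<omega> rotates the orbit by \<open>cnj \<omega>\<close>,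
  so the product \<open>\<beta> n * w n\<close> does not see the phase.\<close>

lemma szego_orbit_phase:
  assumes "cmod \<omega> = 1" "szego_orbit z (\<lambda>n. \<omega> * \<beta> n) w"
  shows "szego_orbit z \<beta> (\<lambda>n. \<omega> * w n)"
proof -
  have "\<omega> * cnj \<omega> = 1" using assms(1) by (simp add: complex_norm_square[symmetric])
  then have "\<omega> * szego_step z (\<omega> * b) v = szego_step z b (\<omega> * v)" for b v
    by (simp add: szego_step_def right_diff_distrib mult.assoc[symmetric])
      (simp add: mult_ac)
  then show ?thesis using assms by (simp add: szego_orbit_def norm_mult)
qed

text \<open>Compactness of a product of discs takes the place of a diagonal extraction; countability
  of the index set makes compactness sequential.\<close>

lemma seq_compact_bounded_functions:
  fixes x :: "nat \<Rightarrow> 'i::countable \<Rightarrow> complex"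
  assumes "\<And>j n. cmod (x j n) \<le> 1"
  obtains r X where "strict_mono (r :: nat \<Rightarrow> nat)" "\<And>n. (\<lambda>j. x (r j) n) \<longlonglongrightarrow> X n"
proof -
  have "compactin (product_topology (\<lambda>_. euclidean) UNIV) (PiE UNIV (\<lambda>_::'i. cball (0::complex) 1))"
    by (simp add: compactin_PiE)
  then have "compact (PiE UNIV (\<lambda>_::'i. cball (0::complex) 1))"
    by (simp add: euclidean_product_topology)
  then have "seq_compact (PiE UNIV (\<lambda>_::'i. cball (0::complex) 1))"
    by (rule compact_imp_seq_compact)
  moreover have "\<forall>j. x j \<in> PiE UNIV (\<lambda>_::'i. cball (0::complex) 1)" using assms by auto
  ultimately obtain X r where "strict_mono (r :: nat \<Rightarrow> nat)" "(x \<circ> r) \<longlonglongrightarrow> X"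
    unfolding seq_compact_def by blast
  then show ?thesis
  proof (intro that[of r X])
    show "(\<lambda>j. x (r j) n) \<longlonglongrightarrow> X n" for n
      using continuous_on_tendsto_compose[OF continuous_on_product_coordinates \<open>(x \<circ> r) \<longlonglongrightarrow> X\<close>]
      by (simp add: o_def)
  qed
qed

lemma norm_right_limit:
  assumes "\<And>n. cmod (\<alpha> n) \<le> 1" "is_right_limit \<alpha> \<beta>"
  shows "cmod (\<beta> n) \<le> 1"
proof -
  obtain N where "(\<lambda>j. \<alpha> (nat (n + N j))) \<longlonglongrightarrow> \<beta> n"
    using assms(2) by (auto simp: is_right_limit_def)
  from tendsto_norm[OF this] show ?thesis using assms(1) by (intro LIMSEQ_le_const2) auto
qed

context
  fixes \<alpha> b :: "nat \<Rightarrow> complex" and z :: complex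
  assumes z: "cmod z < 1" and \<alpha>: "\<And>n. cmod (\<alpha> n) \<le> 1"
    and b1: "\<And>n. cmod (b n) \<le> 1" and bS: "\<And>n. b (Suc n) = szego_step z (\<alpha> n) (b n)"
begin

lemma szego_orbit_limit:
  assumes N: "filterlim N at_top sequentially"
    and \<beta>: "\<And>n. (\<lambda>j. \<alpha> (nat (n + N j))) \<longlonglongrightarrow> \<beta> n"
    and w: "\<And>n. (\<lambda>j. b (nat (n + N j))) \<longlonglongrightarrow> w n"
  shows "szego_orbit z \<beta> w"
  unfolding szego_orbit_def
proof (intro allI conjI)
  fix n
  show w1: "cmod (w n) \<le> 1"
    using tendsto_norm[OF w[of n]] b1 by (intro LIMSEQ_le_const2) auto
  have \<beta>1: "cmod (\<beta> n) \<le> 1"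
    using tendsto_norm[OF \<beta>[of n]] \<alpha> by (intro LIMSEQ_le_const2) auto
  have "(\<lambda>j. szego_step z (\<alpha> (nat (n + N j))) (b (nat (n + N j)))) \<longlonglongrightarrow> szego_step z (\<beta> n) (w n)"
    unfolding szego_step_def
    by (intro tendsto_intros \<beta> w szego_denom(2)[OF z \<beta>1 w1])
  \<comment> \<open>The truncation \<open>nat\<close> commutes with the successor only once
    \<open>n + N j\<close> is nonnegative, which holds eventually.\<close>
  moreover have "\<forall>\<^sub>F j in sequentially.
      szego_step z (\<alpha> (nat (n + N j))) (b (nat (n + N j))) = b (nat (n + 1 + N j))"
    using filterlim_at_top[THEN iffD1, OF N, rule_format, of "- n"]
  proof eventually_elim
    case (elim j)
    then have "nat (n + 1 + N j) = Suc (nat (n + N j))" by simp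
    then show ?case by (simp add: bS)
  qed
  ultimately have "(\<lambda>j. b (nat (n + 1 + N j))) \<longlonglongrightarrow> szego_step z (\<beta> n) (w n)"
    by (rule Lim_transform_eventually)
  then show "w (n + 1) = szego_step z (\<beta> n) (w n)" using w LIMSEQ_unique by blast
qed

text \<open>The sequence defining \<beta> is refined until \<open>b\<close> converges at every site
  too; \<beta> itself survives the refinement.\<close>

lemma right_limit_szego_orbit:
  assumes "is_right_limit \<alpha> \<beta>" "(\<lambda>n. \<alpha> n * b n) \<longlonglongrightarrow> g"
  obtains w where "szego_orbit z \<beta> w" "\<And>n. \<beta> n * w n = g"
proof -
  obtain N where N: "filterlim N at_top sequentially" "\<And>n. (\<lambda>j. \<alpha> (nat (n + N j))) \<longlonglongrightarrow> \<beta> n"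
    using assms(1) by (auto simp: is_right_limit_def)
  obtain r w where r: "strict_mono (r :: nat \<Rightarrow> nat)"
    and w: "\<And>n::int. (\<lambda>j. b (nat (n + N (r j)))) \<longlonglongrightarrow> w n"
    using seq_compact_bounded_functions[of "\<lambda>j n. b (nat (n + N j))"] b1 by blast
  have \<beta>: "(\<lambda>j. \<alpha> (nat (n + N (r j)))) \<longlonglongrightarrow> \<beta> n" for n
    using LIMSEQ_subseq_LIMSEQ[OF N(2) r] by (simp add: o_def)
  have Nr: "filterlim (\<lambda>j. N (r j)) at_top sequentially"
    by (rule filterlim_compose[OF N(1) filterlim_subseq[OF r]])
  have "\<beta> n * w n = g" for n
  proof (rule LIMSEQ_unique)
    show "(\<lambda>j. \<alpha> (nat (n + N (r j))) * b (nat (n + N (r j)))) \<longlonglongrightarrow> \<beta> n * w n"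
      by (intro tendsto_mult \<beta> w)
    have "filterlim (\<lambda>j. nat (n + N (r j))) at_top sequentially"
      unfolding filterlim_at_top
    proof
      fix Z
      show "\<forall>\<^sub>F j in sequentially. Z \<le> nat (n + N (r j))"
        using filterlim_at_top[THEN iffD1, OF Nr, rule_format, of "int Z - n"]
        by eventually_elim linarith
    qed
    from filterlim_compose[OF assms(2) this]
    show "(\<lambda>j. \<alpha> (nat (n + N (r j))) * b (nat (n + N (r j)))) \<longlonglongrightarrow> g" .
  qed
  then show ?thesis by (rule that[OF szego_orbit_limit[OF Nr \<beta> w]])
qed

text \<open>Recentering at \<open>s j\<close> shows every limit point of the products at site 0 of
  some right limit.\<close>

lemma subseq_limit_szego_orbit:
  assumes s: "strict_mono (s :: nat \<Rightarrow> nat)" and g: "(\<lambda>j. \<alpha> (s j) * b (s j)) \<longlonglongrightarrow> g"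
  obtains \<beta> w where "is_right_limit \<alpha> \<beta>" "szego_orbit z \<beta> w" "\<beta> 0 * w 0 = g"
proof -
  obtain r1 \<beta> where r1: "strict_mono (r1 :: nat \<Rightarrow> nat)"
    and \<beta>': "\<And>n::int. (\<lambda>j. \<alpha> (nat (n + int (s (r1 j))))) \<longlonglongrightarrow> \<beta> n"
    using seq_compact_bounded_functions[of "\<lambda>j n. \<alpha> (nat (n + int (s j)))"] \<alpha> by blast
  obtain r2 w where r2: "strict_mono (r2 :: nat \<Rightarrow> nat)"
    and w: "\<And>n::int. (\<lambda>j. b (nat (n + int (s (r1 (r2 j)))))) \<longlonglongrightarrow> w n"
    using seq_compact_bounded_functions[of "\<lambda>j n. b (nat (n + int (s (r1 j))))"] b1 by blast
  have r: "strict_mono (r1 \<circ> r2)" using r1 r2 by (rule strict_mono_o)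
  have \<beta>: "(\<lambda>j. \<alpha> (nat (n + int (s (r1 (r2 j)))))) \<longlonglongrightarrow> \<beta> n" for n
    using LIMSEQ_subseq_LIMSEQ[OF \<beta>' r2] by (simp add: o_def)
  have "filterlim (s \<circ> (r1 \<circ> r2)) at_top sequentially"
    by (rule filterlim_subseq) (intro strict_mono_o s r)
  then have N: "filterlim (\<lambda>j. int (s (r1 (r2 j)))) at_top sequentially"
    by (intro filterlim_compose[OF filterlim_int_sequentially]) (simp add: o_def)
  have "\<beta> 0 * w 0 = g"
  proof (rule LIMSEQ_unique)
    show "(\<lambda>j. \<alpha> (s (r1 (r2 j))) * b (s (r1 (r2 j)))) \<longlonglongrightarrow> \<beta> 0 * w 0"
      using tendsto_mult[OF \<beta>[of 0] w[of 0]] by simp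
    show "(\<lambda>j. \<alpha> (s (r1 (r2 j))) * b (s (r1 (r2 j)))) \<longlonglongrightarrow> g"
      using LIMSEQ_subseq_LIMSEQ[OF g r] by (simp add: o_def)
  qed
  moreover have "is_right_limit \<alpha> \<beta>" unfolding is_right_limit_def
    by (intro exI[of _ "\<lambda>j. int (s (r1 (r2 j)))"] conjI allI N \<beta>)
  ultimately show ?thesis by (intro that[OF _ szego_orbit_limit[OF N \<beta> w]])
qed

text \<open>A bounded sequence with only one limit point converges, and by recentering all its limit
  points have the form \<open>\<beta> 0 * w 0\<close>.\<close>

lemma szego_convergent:
  assumes uniq: "\<And>\<beta> w \<beta>' w'. is_right_limit \<alpha> \<beta> \<Longrightarrow> szego_orbit z \<beta> w \<Longrightarrow>
      is_right_limit \<alpha> \<beta>' \<Longrightarrow> szego_orbit z \<beta>' w' \<Longrightarrow> \<beta> 0 * w 0 = \<beta>' 0 * w' 0"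
  shows "convergent (\<lambda>n. \<alpha> n * b n)"
proof -
  let ?s = "\<lambda>n. \<alpha> n * b n"
  have s1: "?s n \<in> cball 0 1" for n using \<alpha> b1 by (simp add: norm_mult mult_le_one)
  have sub: "\<exists>r g. strict_mono (r :: nat \<Rightarrow> nat) \<and> (\<lambda>j. ?s (f (r j))) \<longlonglongrightarrow> g" for f :: "nat \<Rightarrow> nat"
  proof -
    have "seq_compact (cball (0::complex) 1)" by (intro compact_imp_seq_compact compact_cball)
    moreover have "\<forall>j. (\<lambda>j. ?s (f j)) j \<in> cball 0 1" using s1 by simp
    ultimately have "\<exists>g\<in>cball 0 1. \<exists>r. strict_mono (r :: nat \<Rightarrow> nat) \<and> ((\<lambda>j. ?s (f j)) \<circ> r) \<longlonglongrightarrow> g"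
      unfolding seq_compact_def by (elim allE[of _ "\<lambda>j. ?s (f j)"] mp)
    then show ?thesis by (auto simp: o_def)
  qed
  obtain r g where r: "strict_mono (r :: nat \<Rightarrow> nat)" "(\<lambda>j. ?s (r j)) \<longlonglongrightarrow> g" using sub[of id] by auto
  have "?s \<longlonglongrightarrow> g"
  proof (rule ccontr)
    assume "\<not> ?s \<longlonglongrightarrow> g"
    then obtain e where e: "e > 0" "infinite {n. e \<le> dist (?s n) g}"
      unfolding tendsto_iff cofinite_eq_sequentially[symmetric]
      by (auto simp: not_eventually not_less frequently_cofinite)
    define f where "f = enumerate {n. e \<le> dist (?s n) g}"
    have f: "strict_mono f" "\<And>j. e \<le> dist (?s (f j)) g"
      using strict_mono_enumerate[OF e(2)] enumerate_in_set[OF e(2)] by (auto simp: f_def)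
    obtain q h where q: "strict_mono (q :: nat \<Rightarrow> nat)" "(\<lambda>j. ?s (f (q j))) \<longlonglongrightarrow> h" using sub[of f] by auto
    have "strict_mono (\<lambda>j. f (q j))" using strict_mono_o[OF f(1) q(1)] by (simp add: o_def)
    from subseq_limit_szego_orbit[OF this q(2)]
    obtain \<beta> w where 1: "is_right_limit \<alpha> \<beta>" "szego_orbit z \<beta> w" "\<beta> 0 * w 0 = h" .
    from subseq_limit_szego_orbit[OF r]
    obtain \<beta>' w' where 2: "is_right_limit \<alpha> \<beta>'" "szego_orbit z \<beta>' w'" "\<beta>' 0 * w' 0 = g" .
    have "h = g" using uniq[OF 1(1,2) 2(1,2)] 1(3) 2(3) by simp
    have "e \<le> dist h g"
      by (rule tendsto_lowerbound[OF tendsto_dist[OF q(2) tendsto_const]]) (use f in auto)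
    then show False using \<open>h = g\<close> e(1) by simp
  qed
  then show ?thesis by (auto simp: convergent_def)
qed

end

section \<open>Diagonal entries of powers of whole-line CMV matrices\<close>

text \<open>The only closed path of length \<open>2 (n - m)\<close> reflects once at \<open>n\<close> and once at \<open>m\<close>; it is followed from
  \<open>n\<close> down to \<open>m + 1\<close> along the edge of the support, and back up through transparent sites.\<close>

lemma half_step_reflection:
  fixes m n :: int and \<beta> :: "int \<Rightarrow> complex"
  assumes mn: "m < n" and zero: "\<And>k. m < k \<Longrightarrow> k < n \<Longrightarrow> \<beta> k = 0"
  defines "d \<equiv> nat (n - m)"
  shows "((half_step (n + 1) \<beta> \<circ> half_step n \<beta>) ^^ d) (delta n) n = - \<beta> m * cnj (\<beta> n)"
proof -
  \<comment> \<open>Time is counted in single factors, two for each power of the matrix, so that the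
    edge of the support moves by one site per unit of time.\<close>
  define v where "v = rec_nat (delta n) (\<lambda>t. half_step (n + int t) \<beta>)"
  have v0: "v 0 = delta n" and vS: "v (Suc t) = half_step (n + int t) \<beta> (v t)" for t
    by (simp_all add: v_def)
  have r0: "rho 0 = 1" by (simp add: rho_def)
  have d: "int d = n - m" using mn by (simp add: d_def)
  have v2: "v (2 * l) = ((half_step (n + 1) \<beta> \<circ> half_step n \<beta>) ^^ l) (delta n)" for l
  proof (induction l)
    case 0 show ?case by (simp add: v0)
  next
    case (Suc l)
    have "half_step (n + int (2 * l)) = half_step n" "half_step (n + int (Suc (2 * l))) = half_step (n + 1)"
      by (auto intro!: half_step_cong)
    then show ?case using Suc by (simp add: vS)
  qed
  have down: "v (Suc t) (n - int t) = cnj (\<beta> n) \<and> (\<forall>j < n - int t. v (Suc t) j = 0)" if "t < d" for t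
    using that
  proof (induction t)
    case 0
    show ?case by (auto simp: vS v0 half_step_def Theta1_def Theta2_def delta_def)
  next
    case (Suc t)
    then have IH: "v (Suc t) (n - int t) = cnj (\<beta> n)" "\<And>j. j < n - int t \<Longrightarrow> v (Suc t) j = 0" by auto
    have z: "\<beta> (n - int (Suc t)) = 0" using Suc.prems d by (intro zero) auto
    have e: "even (n - int (Suc t) - (n + int (Suc t)))" by simp
    have s: "n - int (Suc t) + 1 = n - int t" by simp
    have "v (Suc (Suc t)) (n - int (Suc t)) = cnj (\<beta> n)"
      unfolding vS[of "Suc t"] half_step_def if_P[OF e] s using IH z by (simp add: Theta1_def r0)
    moreover have "v (Suc (Suc t)) j = 0" if "j < n - int (Suc t)" for j
      unfolding vS[of "Suc t"] half_step_def using IH that by (auto simp: Theta1_def Theta2_def)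
    ultimately show ?case by blast
  qed
  \<comment> \<open>At time \<open>d\<close> the edge has reached \<open>m + 1\<close> while site
    \<open>m\<close> is still empty, so the block at \<open>m\<close> contributes just the factor
    \<open>- \<beta> m\<close>.\<close>
  have up: "v (d + Suc s) (m + int (Suc s)) = - \<beta> m * cnj (\<beta> n)" if "s < d" for s
    using that
  proof (induction s)
    case 0
    obtain t where t: "d = Suc t" using 0 by (cases d) auto
    then have nt: "n - int t = m + 1" using d by simp
    then have "v d (m + 1) = cnj (\<beta> n)" "v d m = 0" using down[of t] t by auto
    moreover have o: "odd (m + 1 - (n + int d))" using d by simp
    ultimately have "v (Suc d) (m + 1) = - \<beta> m * cnj (\<beta> n)"
      unfolding vS half_step_def if_not_P[OF o] by (simp add: Theta2_def)
    then show ?case by simp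
  next
    case (Suc s)
    have z: "\<beta> (m + int (Suc s)) = 0" using Suc.prems d by (intro zero) auto
    have o: "odd (m + int (Suc (Suc s)) - (n + int (d + Suc s)))" using d by simp
    have s: "m + int (Suc (Suc s)) - 1 = m + int (Suc s)" by simp
    have "v (Suc (d + Suc s)) (m + int (Suc (Suc s))) = Theta2 (\<beta> (m + int (Suc s)))
        (v (d + Suc s) (m + int (Suc s))) (v (d + Suc s) (m + int (Suc (Suc s))))"
      unfolding vS half_step_def if_not_P[OF o] s ..
    then show ?case using Suc z by (simp add: Theta2_def r0 del: of_nat_Suc)
  qed
  obtain t where t: "d = Suc t" using mn d by (cases d) auto
  have "v (2 * d) n = - \<beta> m * cnj (\<beta> n)" using up[of t] t d by (simp add: mult_2)
  then show ?thesis by (simp add: v2)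
qed

text \<open>Induction on the gap: once shorter gaps are excluded, all sites between two nonzero
  coefficients are transparent, and the reflected path gives a nonzero diagonal entry.\<close>

lemma K_infty_imp:
  assumes "whole_CMV \<beta> \<in> K_infty" "m < n"
  shows "\<beta> m = 0 \<or> \<beta> n = 0"
  using assms(2)
proof (induction "nat (n - m)" arbitrary: m n rule: less_induct)
  case less
  show ?case
  proof (rule ccontr)
    assume nz: "\<not> (\<beta> m = 0 \<or> \<beta> n = 0)"
    have zero: "\<beta> k = 0" if "m < k" "k < n" for k
      using less.hyps[of k m] that nz by auto
    \<comment> \<open>The path begins with the factor of the parity of \<open>n\<close>, whereas the
      matrix applies its odd factor first; for even \<open>n\<close> the order is reversed by
      transposition.\<close>
    have "((half_step 0 \<beta> \<circ> half_step 1 \<beta>) ^^ nat (n - m)) (delta n) n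
        = ((half_step (n + 1) \<beta> \<circ> half_step n \<beta>) ^^ nat (n - m)) (delta n) n"
    proof (cases "even n")
      case True
      then have "half_step n = half_step 0" "half_step (n + 1) = half_step 1"
        by (auto intro!: half_step_cong)
      then show ?thesis by (simp only: half_step_pow_transpose[where p = 0 and q = 1])
    next
      case False
      then have "half_step n = half_step 1" "half_step (n + 1) = half_step 0"
        by (auto intro!: half_step_cong)
      then show ?thesis by simp
    qed
    also have "\<dots> = - \<beta> m * cnj (\<beta> n)" by (rule half_step_reflection[OF less.prems zero])
    finally have "entry (whole_CMV \<beta> ^^ nat (n - m)) n n \<noteq> 0" using nz
      by (simp add: entry_pow whole_CMV_eq)
    moreover have "nat (n - m) \<ge> 1" using less.prems by simp
    ultimately show False using assms(1) by (auto simp: K_infty_def)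
  qed
qed

lemma whole_CMV_apply:
  "odd j \<Longrightarrow> whole_CMV \<beta> u j = rho (\<beta> (j - 1)) * (rho (\<beta> (j - 2)) * u (j - 2) - \<beta> (j - 2) * u (j - 1))
     - \<beta> (j - 1) * (cnj (\<beta> j) * u j + rho (\<beta> j) * u (j + 1))"
  "even j \<Longrightarrow> whole_CMV \<beta> u j = cnj (\<beta> j) * (rho (\<beta> (j - 1)) * u (j - 1) - \<beta> (j - 1) * u j)
     + rho (\<beta> j) * (cnj (\<beta> (j + 1)) * u (j + 1) + rho (\<beta> (j + 1)) * u (j + 2))"
  by (simp_all add: whole_CMV_eq half_step_def Theta1_def Theta2_def add.assoc)

text \<open>Amplitude at odd sites moves up by two and at even sites moves down by two, and a single
  reflecting site \<open>m\<close> lets each wave turn around at most once.\<close>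

lemma K_infty_if:
  assumes "\<And>n. cmod (\<beta> n) \<le> 1" and zero: "\<And>k. k \<noteq> m \<Longrightarrow> \<beta> k = 0"
  shows "whole_CMV \<beta> \<in> K_infty"
proof -
  have *: "(whole_CMV \<beta> ^^ Suc l) (delta k) k = 0" for k l
  proof (cases "odd k")
    case True
    \<comment> \<open>Amplitude at even sites could feed odd sites only from above \<open>m\<close>,
      where the second condition keeps it zero. So the lower front \<open>p\<close> of the odd sites
      advances by 2 in each step and never returns to \<open>k\<close>. The even case mirrors
      this.\<close>
    define V where "V p u \<longleftrightarrow> (\<forall>j::int. odd j \<and> j < p \<longrightarrow> u j = 0) \<and> (\<forall>j. even j \<and> m < j \<longrightarrow> u j = (0::complex))" for p u
    have step: "V (p + 2) (whole_CMV \<beta> u)" if V: "V p u" for p u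
      unfolding V_def
    proof (intro conjI allI impI)
      fix j :: int assume j: "odd j \<and> j < p + 2"
      have "u (j - 2) = 0" using V j by (auto simp: V_def)
      moreover have "\<beta> (j - 2) * u (j - 1) = 0" using V j zero[of "j - 2"] by (cases "j - 2 = m") (auto simp: V_def)
      moreover have "\<beta> (j - 1) = 0 \<or> \<beta> j = 0" using zero[of "j - 1"] zero[of j] by (cases "j = m") auto
      moreover have "\<beta> (j - 1) = 0 \<or> u (j + 1) = 0" using V j zero[of "j - 1"] by (cases "j - 1 = m") (auto simp: V_def)
      ultimately show "whole_CMV \<beta> u j = 0" using j by (auto simp: whole_CMV_apply)
    next
      fix j :: int assume j: "even j \<and> m < j"
      then have "\<beta> j = 0" "\<beta> (j + 1) = 0" by (auto intro: zero)
      moreover have "u (j + 2) = 0" using V j by (auto simp: V_def)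
      ultimately show "whole_CMV \<beta> u j = 0" using j by (auto simp: whole_CMV_apply)
    qed
    have "V (k + 2) (whole_CMV \<beta> (delta k))"
      unfolding V_def
    proof (intro conjI allI impI)
      fix j :: int assume j: "odd j \<and> j < k + 2"
      have "\<beta> (j - 1) = 0 \<or> \<beta> j = 0" using zero[of "j - 1"] zero[of j] by (cases "j = m") auto
      moreover have "delta k (j + 1) = 0" "delta k (j - 1) = 0" "delta k (j - 2) = 0"
        using j True by (auto simp: delta_def)
      ultimately show "whole_CMV \<beta> (delta k) j = 0" using j by (auto simp: whole_CMV_apply)
    next
      fix j :: int assume j: "even j \<and> m < j"
      then have "\<beta> j = 0" "\<beta> (j + 1) = 0" by (auto intro: zero)
      moreover have "delta k (j + 2) = 0" using j True by (auto simp: delta_def)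
      ultimately show "whole_CMV \<beta> (delta k) j = 0" using j by (auto simp: whole_CMV_apply)
    qed
    then have "V (k + 2 + 2 * int l) ((whole_CMV \<beta> ^^ Suc l) (delta k))"
    proof (induction l)
      case (Suc l)
      from step[OF Suc.IH[OF Suc.prems]] show ?case by (simp add: algebra_simps)
    qed simp
    then show ?thesis using True by (simp add: V_def)
  next
    case False
    define V where "V p u \<longleftrightarrow> (\<forall>j::int. even j \<and> p < j \<longrightarrow> u j = 0) \<and> (\<forall>j. odd j \<and> j \<le> m \<longrightarrow> u j = (0::complex))" for p u
    have step: "V (p - 2) (whole_CMV \<beta> u)" if V: "V p u" for p u
      unfolding V_def
    proof (intro conjI allI impI)
      fix j :: int assume j: "even j \<and> p - 2 < j"
      have "u (j + 2) = 0" using V j by (auto simp: V_def)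
      moreover have "\<beta> j = 0 \<or> u (j - 1) = 0" using V j zero[of j] by (cases "j = m") (auto simp: V_def)
      moreover have "\<beta> (j - 1) = 0 \<or> \<beta> j = 0" using zero[of "j - 1"] zero[of j] by (cases "j = m") auto
      moreover have "\<beta> (j + 1) = 0 \<or> u (j + 1) = 0" using V j zero[of "j + 1"] by (cases "j + 1 = m") (auto simp: V_def)
      ultimately show "whole_CMV \<beta> u j = 0" using j by (auto simp: whole_CMV_apply)
    next
      fix j :: int assume j: "odd j \<and> j \<le> m"
      then have "\<beta> (j - 1) = 0" "\<beta> (j - 2) = 0" by (auto intro: zero)
      moreover have "u (j - 2) = 0" using V j by (auto simp: V_def)
      ultimately show "whole_CMV \<beta> u j = 0" using j by (auto simp: whole_CMV_apply)
    qed
    have "V (k - 2) (whole_CMV \<beta> (delta k))"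
      unfolding V_def
    proof (intro conjI allI impI)
      fix j :: int assume j: "even j \<and> k - 2 < j"
      have "\<beta> (j - 1) = 0 \<or> \<beta> j = 0" using zero[of "j - 1"] zero[of j] by (cases "j = m") auto
      moreover have "delta k (j + 1) = 0" "delta k (j - 1) = 0" "delta k (j + 2) = 0"
        using j False by (auto simp: delta_def)
      ultimately show "whole_CMV \<beta> (delta k) j = 0" using j by (auto simp: whole_CMV_apply)
    next
      fix j :: int assume j: "odd j \<and> j \<le> m"
      then have "\<beta> (j - 1) = 0" "\<beta> (j - 2) = 0" by (auto intro: zero)
      moreover have "delta k (j - 2) = 0" using j False by (auto simp: delta_def)
      ultimately show "whole_CMV \<beta> (delta k) j = 0" using j by (auto simp: whole_CMV_apply)
    qed
    then have "V (k - 2 - 2 * int l) ((whole_CMV \<beta> ^^ Suc l) (delta k))"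
    proof (induction l)
      case (Suc l)
      from step[OF Suc.IH[OF Suc.prems]] show ?case by (simp add: algebra_simps)
    qed simp
    then show ?thesis using False by (simp add: V_def)
  qed
  have "entry (whole_CMV \<beta> ^^ l) n n = 0" if "l \<ge> 1" for n l
  proof (cases l)
    case (Suc k)
    then show ?thesis using * by (simp only: entry_pow)
  qed (use that in simp)
  moreover have "whole_CMV \<beta> \<in> whole_CMV_matrices" using assms(1) by (auto simp: whole_CMV_matrices_def)
  ultimately show ?thesis by (simp add: K_infty_def)
qed

section \<open>Ratio asymptotics and right limits\<close>

definition szego_quot :: "(nat \<Rightarrow> complex) \<Rightarrow> complex \<Rightarrow> nat \<Rightarrow> complex" where
  "szego_quot \<alpha> z n = poly (szego_poly \<alpha> n) z / poly (rev_poly (szego_poly \<alpha> n)) z"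

text \<open>Nonvanishing and the bound by 1 are proved together: the next reversed polynomial is the
  current one times \<open>1 - \<alpha> n * (z * b n)\<close>, and this factor is nonzero by the
  bound.\<close>

lemma szego_quot:
  assumes "\<And>n. cmod (\<alpha> n) < 1" "cmod z < 1"
  shows "poly (rev_poly (szego_poly \<alpha> n)) z \<noteq> 0" "cmod (szego_quot \<alpha> z n) \<le> 1"
    and "szego_quot \<alpha> z (Suc n) = szego_step z (\<alpha> n) (szego_quot \<alpha> z n)"
    and "poly (rev_poly (szego_poly \<alpha> (Suc n))) z / poly (rev_poly (szego_poly \<alpha> n)) z
       = 1 - z * (\<alpha> n * szego_quot \<alpha> z n)"
proof -
  let ?p = "\<lambda>n. poly (szego_poly \<alpha> n) z" and ?q = "\<lambda>n. poly (rev_poly (szego_poly \<alpha> n)) z"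
  let ?b = "szego_quot \<alpha> z"
  have p: "?p (Suc n) = z * ?p n - cnj (\<alpha> n) * ?q n" for n by simp
  have q: "?q (Suc n) = ?q n - \<alpha> n * (z * ?p n)" for n unfolding rev_szego_poly_Suc by simp
  have q1: "?q (Suc n) = ?q n * (1 - \<alpha> n * (z * ?b n))" if "?q n \<noteq> 0" for n
    using that unfolding q szego_quot_def by (simp add: field_simps)
  have p1: "?p (Suc n) = ?q n * (z * ?b n - cnj (\<alpha> n))" if "?q n \<noteq> 0" for n
    using that unfolding p szego_quot_def by (simp add: field_simps)
  have b1: "?b (Suc n) = szego_step z (\<alpha> n) (?b n)" if "?q n \<noteq> 0" for n
    unfolding szego_quot_def[of _ _ "Suc n"] p1[OF that] q1[OF that] szego_step_def using that by simp
  have *: "?q n \<noteq> 0 \<and> cmod (?b n) \<le> 1" for n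
  proof (induction n)
    case 0 show ?case by (simp add: szego_quot_def rev_poly_def)
  next
    case (Suc n)
    then show ?case
      using szego_denom(2)[OF assms(2) less_imp_le[OF assms(1)[of n]], of "?b n"]
        norm_szego_step[OF assms(2) less_imp_le[OF assms(1)[of n]], of "?b n"]
      unfolding b1[OF Suc[THEN conjunct1]] q1[OF Suc[THEN conjunct1]] by simp
  qed
  show "?q n \<noteq> 0" "cmod (?b n) \<le> 1" using * by auto
  show "?b (Suc n) = szego_step z (\<alpha> n) (?b n)" using * b1 by blast
  show "?q (Suc n) / ?q n = 1 - z * (\<alpha> n * ?b n)" using * q1[of n] by (simp add: mult_ac)
qed

text \<open>Dividing by \<open>z\<close> turns the limit \<open>G\<close> of
  \<open>1 - z * (\<alpha> n * b n)\<close> into a limit of the products themselves.\<close>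

lemma ratio_asymptotics_right_limit:
  assumes \<alpha>: "\<And>n. cmod (\<alpha> n) < 1" and z: "cmod z < 1" "z \<noteq> 0"
    and ra: "ratio_asymptotics_at (szego_poly \<alpha>) z G" and rl: "is_right_limit \<alpha> \<beta>"
  obtains w where "szego_orbit z \<beta> w" "\<And>n. \<beta> n * w n = (1 - G) / z"
proof -
  have "(\<lambda>n. 1 - z * (\<alpha> n * szego_quot \<alpha> z n)) \<longlonglongrightarrow> G"
    using ra unfolding ratio_asymptotics_at_def szego_quot(4)[of \<alpha> z, OF \<alpha> z(1)] .
  then have "(\<lambda>n. (1 - (1 - z * (\<alpha> n * szego_quot \<alpha> z n))) / z) \<longlonglongrightarrow> (1 - G) / z"
    by (intro tendsto_intros) (use z in auto)
  then have "(\<lambda>n. \<alpha> n * szego_quot \<alpha> z n) \<longlonglongrightarrow> (1 - G) / z" using z by simp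
  from right_limit_szego_orbit[where \<alpha> = \<alpha> and b = "szego_quot \<alpha> z", OF z(1) less_imp_le[OF \<alpha>] szego_quot(2,3)[of \<alpha> z, OF \<alpha> z(1)] rl this]
  show ?thesis using that by blast
qed

lemma ratio_asymptotic_if_unique:
  assumes \<alpha>: "\<And>n. cmod (\<alpha> n) < 1"
    and uniq: "\<And>z \<beta> w \<beta>' w'. cmod z < 1 \<Longrightarrow> is_right_limit \<alpha> \<beta> \<Longrightarrow> szego_orbit z \<beta> w \<Longrightarrow>
      is_right_limit \<alpha> \<beta>' \<Longrightarrow> szego_orbit z \<beta>' w' \<Longrightarrow> \<beta> 0 * w 0 = \<beta>' 0 * w' 0"
  shows "ratio_asymptotic (szego_poly \<alpha>)"
  unfolding ratio_asymptotic_def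
proof
  fix z :: complex assume "z \<in> ball 0 1"
  then have z: "cmod z < 1" by simp
  have "convergent (\<lambda>n. \<alpha> n * szego_quot \<alpha> z n)"
    by (rule szego_convergent[where \<alpha> = \<alpha> and b = "szego_quot \<alpha> z", OF z less_imp_le[OF \<alpha>] szego_quot(2,3)[of \<alpha> z, OF \<alpha> z]])
      (rule uniq[OF z])
  then obtain g where "(\<lambda>n. \<alpha> n * szego_quot \<alpha> z n) \<longlonglongrightarrow> g" by (auto simp: convergent_def)
  then have "(\<lambda>n. 1 - z * (\<alpha> n * szego_quot \<alpha> z n)) \<longlonglongrightarrow> 1 - z * g" by (intro tendsto_intros)
  then show "\<exists>G. ratio_asymptotics_at (szego_poly \<alpha>) z G"
    unfolding ratio_asymptotics_at_def szego_quot(4)[of \<alpha> z, OF \<alpha> z] by blast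
qed

text \<open>If \<open>\<beta> 0\<close> is nonzero, all earlier sites are transparent and each only
  multiplies by \<open>z\<close>; a bounded orbit coming from minus infinity has therefore decayed
  to 0 at site 0.\<close>

lemma szego_orbit_K_infty:
  assumes z: "cmod z < 1" and w: "szego_orbit z \<beta> w"
    and \<beta>: "\<And>m n. m < n \<Longrightarrow> \<beta> m = 0 \<or> \<beta> n = 0"
  shows "\<beta> 0 * w 0 = 0"
proof (cases "\<beta> 0 = 0")
  case False
  have "w (- int k) * z ^ k = w 0" for k
  proof (induction k)
    case (Suc k)
    have "w (- int (Suc k) + 1) = szego_step z (\<beta> (- int (Suc k))) (w (- int (Suc k)))"
      using w unfolding szego_orbit_def by blast
    moreover have "\<beta> (- int (Suc k)) = 0" using \<beta>[of "- int (Suc k)" 0] False by simp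
    ultimately have "w (- int k) = z * w (- int (Suc k))" by (simp add: szego_step_def)
    then show ?case using Suc by (simp add: mult_ac)
  qed simp
  then have "cmod (w 0) \<le> cmod z ^ k" for k
    using w by (metis mult_left_le_one_le norm_ge_zero norm_mult norm_power szego_orbit_def zero_le_power)
  moreover have "(\<lambda>k. cmod z ^ k) \<longlonglongrightarrow> 0" using z by (intro LIMSEQ_power_zero) simp
  ultimately have "cmod (w 0) \<le> 0" by (intro LIMSEQ_le_const) auto
  then show ?thesis by simp
qed simp

text \<open>A nonzero \<open>\<beta> m\<close> forces \<open>w m = 0\<close>, hence
  \<open>w (m + 1) \<noteq> 0\<close>. From then on a nonzero \<open>w\<close> forces the
  coefficient to vanish, and the step is multiplication by \<open>z \<noteq> 0\<close>, so
  \<open>w\<close> never returns to 0.\<close>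

lemma szego_orbit_zero_product:
  assumes z: "z \<noteq> 0" and w: "szego_orbit z \<beta> w" and zero: "\<And>n. \<beta> n * w n = 0" and mn: "m < n"
  shows "\<beta> m = 0 \<or> \<beta> n = 0"
proof (rule ccontr)
  assume nz: "\<not> (\<beta> m = 0 \<or> \<beta> n = 0)"
  have step: "w (k + 1) = z * w k - cnj (\<beta> k)" for k
  proof -
    have d: "\<beta> k * (z * w k) = 0" using zero[of k] by auto
    have "w (k + 1) = szego_step z (\<beta> k) (w k)" using w by (simp add: szego_orbit_def)
    then show ?thesis unfolding szego_step_def d by simp
  qed
  have "w (m + 1 + int k) \<noteq> 0" for k
  proof (induction k)
    case 0
    then show ?case using zero[of m] nz step[of m] by simp
  next
    case (Suc k)
    then have "\<beta> (m + 1 + int k) = 0" using zero[of "m + 1 + int k"] by simp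
    then show ?case using Suc z step[of "m + 1 + int k"] by (simp add: add_ac)
  qed
  from this[of "nat (n - m - 1)"] have "w n \<noteq> 0" using mn by simp
  then show False using zero[of n] nz by simp
qed

text \<open>Multiplying the recursion by \<open>\<beta> n * \<beta> (n + 1)\<close> turns every
  \<open>w\<close> into \<open>g\<close> and leaves a relation among the coefficients alone.\<close>

lemma szego_orbit_const_product:
  assumes z: "cmod z < 1" and w: "szego_orbit z \<beta> w" and \<beta>: "\<And>n. cmod (\<beta> n) \<le> 1"
    and g: "\<And>n. \<beta> n * w n = g"
  shows "(z * g - \<beta> n * cnj (\<beta> n)) * \<beta> (n + 1) = g * (1 - z * g) * \<beta> n" and "1 - z * g \<noteq> 0"
proof -
  have g': "\<beta> n * (z * w n) = z * g" for n using g[of n] by (simp add: mult_ac)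
  have "cmod (w n) \<le> 1" using w by (simp add: szego_orbit_def)
  from szego_denom(2)[OF z \<beta>[of n] this] show h: "1 - z * g \<noteq> 0" by (simp add: g')
  have "w (n + 1) = (z * w n - cnj (\<beta> n)) / (1 - z * g)"
    using w by (simp add: szego_orbit_def szego_step_def g')
  then have "w (n + 1) * (1 - z * g) = z * w n - cnj (\<beta> n)" using h by simp
  then have "\<beta> n * \<beta> (n + 1) * (w (n + 1) * (1 - z * g)) = \<beta> n * \<beta> (n + 1) * (z * w n - cnj (\<beta> n))" by simp
  moreover have "\<beta> n * \<beta> (n + 1) * (w (n + 1) * (1 - z * g)) = (\<beta> (n + 1) * w (n + 1)) * (1 - z * g) * \<beta> n" by simp
  moreover have "\<beta> n * \<beta> (n + 1) * (z * w n - cnj (\<beta> n)) = (\<beta> n * (z * w n) - \<beta> n * cnj (\<beta> n)) * \<beta> (n + 1)"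
    by (simp add: algebra_simps)
  ultimately show "(z * g - \<beta> n * cnj (\<beta> n)) * \<beta> (n + 1) = g * (1 - z * g) * \<beta> n"
    by (simp only: g g')
qed

text \<open>Cross-multiplying the relations at the two points eliminates
  \<open>\<beta> (n + 1)\<close> and leaves a linear equation for |\<beta> n|^2 with coefficient
  \<open>a2 - a1\<close>; its solution is \<open>x\<close>.\<close>

lemma two_point_coeffs:
  assumes z1: "cmod z1 < 1" "szego_orbit z1 \<beta> w1" "\<And>n. \<beta> n * w1 n = g1" "g1 \<noteq> 0"
    and z2: "cmod z2 < 1" "szego_orbit z2 \<beta> w2" "\<And>n. \<beta> n * w2 n = g2" "g2 \<noteq> 0"
    and \<beta>: "\<And>n. cmod (\<beta> n) \<le> 1" and ne: "z1 \<noteq> z2"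
  defines "a1 \<equiv> g1 * (1 - z1 * g1)" and "a2 \<equiv> g2 * (1 - z2 * g2)"
  defines "x \<equiv> (a2 * (z1 * g1) - a1 * (z2 * g2)) / (a2 - a1)"
  shows "\<beta> n \<noteq> 0" "\<beta> n * cnj (\<beta> n) = x" "\<beta> (n + 1) = a1 / (z1 * g1 - x) * \<beta> n"
proof -
  note c1 = szego_orbit_const_product[OF z1(1,2) \<beta> z1(3), folded a1_def]
    and c2 = szego_orbit_const_product[OF z2(1,2) \<beta> z2(3), folded a2_def]
  have nz: "\<beta> n \<noteq> 0" for n using z1(3)[of n] z1(4) by auto
  have a: "a1 \<noteq> 0" "a2 \<noteq> 0" using c1(2) c2(2) z1(4) z2(4) by (auto simp: a1_def a2_def)
  have "a1 \<noteq> a2"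
  proof
    \<comment> \<open>Equality would give \<open>z1 * g1 = z2 * g2\<close>, then
      \<open>g1 = g2\<close> after cancelling 1 - z g, and finally \<open>z1 = z2\<close>.\<close>
    assume eq: "a1 = a2"
    let ?y = "\<beta> 0 * cnj (\<beta> 0)"
    have "(z1 * g1 - ?y) * \<beta> 1 = (z2 * g2 - ?y) * \<beta> 1" using c1(1)[of 0] c2(1)[of 0] eq by simp
    then have zg: "z1 * g1 = z2 * g2" using nz[of 1] by simp
    then have "g1 = g2" using eq c1(2) by (simp add: a1_def a2_def)
    then show False using zg ne z1(4) by simp
  qed
  have x: "\<beta> n * cnj (\<beta> n) = x" for n
  proof -
    let ?y = "\<beta> n * cnj (\<beta> n)"
    have "a1 * \<beta> n * (z2 * g2 - ?y) = (z1 * g1 - ?y) * \<beta> (n + 1) * (z2 * g2 - ?y)" by (simp only: c1(1))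
    also have "\<dots> = (z2 * g2 - ?y) * \<beta> (n + 1) * (z1 * g1 - ?y)" by (simp only: mult_ac)
    also have "\<dots> = a2 * \<beta> n * (z1 * g1 - ?y)" by (simp only: c2(1))
    finally have "\<beta> n * (a1 * (z2 * g2 - ?y)) = \<beta> n * (a2 * (z1 * g1 - ?y))" by (simp only: mult_ac)
    then have "a1 * (z2 * g2 - ?y) = a2 * (z1 * g1 - ?y)" using nz[of n] by simp
    then have "?y * (a2 - a1) = a2 * (z1 * g1) - a1 * (z2 * g2)" by (simp only: algebra_simps) 
    then show ?thesis using \<open>a1 \<noteq> a2\<close> by (simp add: x_def eq_divide_eq)
  qed
  show "\<beta> n \<noteq> 0" "\<beta> n * cnj (\<beta> n) = x" by (rule nz x)+
  have e: "(z1 * g1 - x) * \<beta> (n + 1) = a1 * \<beta> n" using c1(1)[of n] by (simp add: x)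
  then have "z1 * g1 - x \<noteq> 0" using a nz[of n] by auto
  then show "\<beta> (n + 1) = a1 / (z1 * g1 - x) * \<beta> n" using e by (simp add: field_simps)
qed

text \<open>All diagonal entries of a given power agree, so a spectral measure of
  \<open>delta 0\<close> has the moments required at every \<open>delta n\<close>. The constant is
  the diagonal entry at site 1.\<close>

lemma whole_CMV_in_K1_tilde:
  assumes \<beta>: "\<And>n. cmod (\<beta> n) \<le> 1" and "cmod \<omega> = 1" and S: "\<And>n. \<beta> (n + 1) = \<omega> * \<beta> n"
  shows "whole_CMV \<beta> \<in> K1_tilde (- cnj (\<beta> 1) * \<beta> 0)"
proof -
  have diag: "(whole_CMV \<beta> ^^ l) (delta n) n = (whole_CMV \<beta> ^^ l) (delta 0) 0" for l n
  proof (induction n rule: int_induct[where k = 0])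
    case (step1 i) then show ?case using whole_CMV_pow_diag_const[where \<beta> = \<beta>, OF assms(2) S, of l i] by simp
  next
    case (step2 i) then show ?case using whole_CMV_pow_diag_const[where \<beta> = \<beta>, OF assms(2) S, of l "i - 1"] by simp
  qed simp
  obtain \<nu> where \<nu>: "is_spectral_measure (whole_CMV \<beta>) (delta 0) \<nu>"
    using whole_CMV_spectral_measure[of \<beta>, OF \<beta>] by blast
  then have "is_spectral_measure (whole_CMV \<beta>) (delta n) \<nu>" for n
    unfolding is_spectral_measure_def ell2_inner_delta diag[of _ n] .
  then have K: "whole_CMV \<beta> \<in> Khrushchev_class"
    using \<beta> by (auto simp: Khrushchev_class_def whole_CMV_matrices_def)
  have "entry (whole_CMV \<beta>) n n = entry (whole_CMV \<beta>) 1 1" for n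
    using diag[of 1 n] diag[of 1 1] by (simp add: entry_def ell2_inner_delta)
  then have "whole_CMV \<beta> \<in> K1 (- cnj (\<beta> 1) * \<beta> 0)"
    using K by (simp add: K1_def entry_whole_CMV_diag)
  moreover have norm0: "cmod (\<beta> n) = cmod (\<beta> 0)" for n
  proof (induction n rule: int_induct[where k = 0])
    case (step1 i) then show ?case using S[of i] assms(2) by (simp add: norm_mult)
  next
    case (step2 i) then show ?case using S[of "i - 1"] assms(2) by (simp add: norm_mult)
  qed simp
  then have "cmod (\<beta> m) = cmod (\<beta> n)" for m n by (simp only: norm0[of m] norm0[of n])
  ultimately show ?thesis using \<beta> unfolding K1_tilde_def by blast
qed

text \<open>As \<open>x\<close> and \<omega> are common to all right limits, so is the diagonal
  entry \<open>- cnj \<omega> * x\<close>, and a right limit is determined by its value at 0, of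
  which only the phase is free.\<close>

lemma unique_right_limit_in_K1_tilde:
  assumes \<alpha>: "\<And>n. cmod (\<alpha> n) \<le> 1"
    and nz: "\<And>\<beta> n. is_right_limit \<alpha> \<beta> \<Longrightarrow> \<beta> n \<noteq> 0"
    and x: "\<And>\<beta> n. is_right_limit \<alpha> \<beta> \<Longrightarrow> \<beta> n * cnj (\<beta> n) = x"
    and \<omega>: "\<And>\<beta> n. is_right_limit \<alpha> \<beta> \<Longrightarrow> \<beta> (n + 1) = \<omega> * \<beta> n"
  shows "\<exists>c. cmod c \<le> 1 \<and> c \<noteq> 0 \<and> unique_right_limit_in \<alpha> (K1_tilde c)"
proof (cases "\<exists>\<beta>. is_right_limit \<alpha> \<beta>")
  case False
  then show ?thesis
    \<comment> \<open>Without right limits the claim is vacuous, and 1 is merely an admissible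
      constant.\<close>
    by (intro exI[of _ 1]) (simp add: unique_right_limit_in_def all_right_limits_in_def)
next
  case True
  then obtain \<beta>0 where \<beta>0: "is_right_limit \<alpha> \<beta>0" by blast
  note \<beta>1 = norm_right_limit[OF \<alpha>]
  have norm: "(cmod (\<beta> n))\<^sup>2 = cmod x" if "is_right_limit \<alpha> \<beta>" for \<beta> n
    using x[OF that, of n, symmetric] by (simp add: norm_mult power2_eq_square)
  have norm': "cmod (\<beta> m) = cmod (\<beta>' n)" if "is_right_limit \<alpha> \<beta>" "is_right_limit \<alpha> \<beta>'" for \<beta> \<beta>' m n
    by (rule power2_eq_imp_eq) (simp_all only: norm[OF that(1)] norm[OF that(2)] norm_ge_zero)
  have "cmod \<omega> = 1"
    using \<omega>[OF \<beta>0, of 0] norm'[OF \<beta>0 \<beta>0, of 1 0] nz[OF \<beta>0, of 0] by (simp add: norm_mult)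
  have c: "- cnj (\<beta> 1) * \<beta> 0 = - cnj \<omega> * x" if "is_right_limit \<alpha> \<beta>" for \<beta>
    using \<omega>[OF that, of 0] x[OF that, of 0] by (simp add: mult_ac)
  define c0 where "c0 = - cnj \<omega> * x"
  have "c0 = - cnj (\<beta>0 1) * \<beta>0 0" by (simp only: c0_def c[OF \<beta>0])
  then have c0: "cmod c0 \<le> 1" "c0 \<noteq> 0"
    using nz[OF \<beta>0] \<beta>1[OF \<beta>0] by (simp_all add: norm_mult mult_le_one)
  have in_K: "whole_CMV \<beta> \<in> K1_tilde c0" if "is_right_limit \<alpha> \<beta>" for \<beta>
    using whole_CMV_in_K1_tilde[where \<beta> = \<beta>, OF \<beta>1[OF that] \<open>cmod \<omega> = 1\<close> \<omega>[OF that]] unfolding c[OF that] c0_def .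
  have "\<exists>\<phi>. \<forall>n. \<beta>' n = cis \<phi> * \<beta> n" if b: "is_right_limit \<alpha> \<beta>" and b': "is_right_limit \<alpha> \<beta>'" for \<beta> \<beta>'
  proof -
    define q where "q = \<beta>' 0 / \<beta> 0"
    have "cmod q = 1" using norm'[OF b' b, of 0 0] nz[OF b, of 0] by (simp add: q_def norm_divide)
    then have "cis (Arg q) = q" by (subst cis_Arg) (auto simp: sgn_div_norm)
    then have 0: "\<beta>' 0 = cis (Arg q) * \<beta> 0" using nz[OF b, of 0] by (simp add: q_def)
    have "\<beta>' n = cis (Arg q) * \<beta> n" for n
    proof (induction n rule: int_induct[where k = 0])
      case base show ?case by (rule 0)
    next
      case (step1 i) then show ?case using \<omega>[OF b, of i] \<omega>[OF b', of i] by simp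
    next
      case (step2 i)
      have eq: "\<omega> * \<beta>' (i - 1) = \<omega> * (cis (Arg q) * \<beta> (i - 1))"
      proof -
        have "\<beta> i = \<omega> * \<beta> (i - 1)" "\<beta>' i = \<omega> * \<beta>' (i - 1)"
          using \<omega>[OF b, of "i - 1"] \<omega>[OF b', of "i - 1"] by simp_all
        from step2(2)[unfolded this] show ?thesis by (simp only: mult.left_commute)
      qed
      have "\<omega> \<noteq> 0" using \<open>cmod \<omega> = 1\<close> by auto
      from mult_left_cancel[OF this, THEN iffD1, OF eq] show ?case .
    qed
    then show ?thesis by blast
  qed
  then show ?thesis using c0 in_K
    by (intro exI[of _ c0]) (simp add: unique_right_limit_in_def all_right_limits_in_def)
qed

theorem theorem4p10:
  fixes \<alpha> :: "nat \<Rightarrow> complex"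
    and \<mu> :: "complex measure"
    and \<Phi> :: "nat \<Rightarrow> complex poly"
  assumes "\<forall>n. cmod (\<alpha> n) < 1"
    and "is_spectral_measure (half_CMV \<alpha>) (delta 0) \<mu>"
    and "\<forall>n. is_monic_OP \<mu> n (\<Phi> n)"
  shows
    "((all_right_limits_in \<alpha> K_infty \<or>
       (\<exists>c. cmod c \<le> 1 \<and> c \<noteq> 0 \<and> unique_right_limit_in \<alpha> (K1_tilde c)))
      \<longrightarrow> ratio_asymptotic \<Phi>) \<and>
     ((\<exists>z0 \<in> ball 0 1 - {0}. ratio_asymptotics_at \<Phi> z0 1)
      \<longrightarrow> all_right_limits_in \<alpha> K_infty) \<and>
     ((\<exists>z1 \<in> ball 0 1 - {0}. \<exists>z2 \<in> ball 0 1 - {0}. \<exists>G1 G2.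
         z1 \<noteq> z2 \<and> G1 \<noteq> 1 \<and> G2 \<noteq> 1 \<and>
         ratio_asymptotics_at \<Phi> z1 G1 \<and> ratio_asymptotics_at \<Phi> z2 G2)
      \<longrightarrow> (\<exists>c. cmod c \<le> 1 \<and> c \<noteq> 0 \<and> unique_right_limit_in \<alpha> (K1_tilde c)))"
proof -
  have \<alpha>: "cmod (\<alpha> n) < 1" for n using assms(1) by blast
  note \<alpha>' = less_imp_le[OF \<alpha>] and \<beta>1 = norm_right_limit[OF less_imp_le[OF \<alpha>]]
  have \<Phi>: "\<Phi> = szego_poly \<alpha>"
    by (rule ext, rule monic_OP_eq_szego_poly[OF \<alpha> assms(2)]) (use assms(3) in blast)
  show ?thesis unfolding \<Phi>
  proof (intro conjI impI)
    assume "all_right_limits_in \<alpha> K_infty \<or>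
       (\<exists>c. cmod c \<le> 1 \<and> c \<noteq> 0 \<and> unique_right_limit_in \<alpha> (K1_tilde c))"
    then show "ratio_asymptotic (szego_poly \<alpha>)"
    proof
      assume K: "all_right_limits_in \<alpha> K_infty"
      have zero: "\<beta> 0 * w 0 = 0" if "cmod z < 1" "is_right_limit \<alpha> \<beta>" "szego_orbit z \<beta> w" for z \<beta> w
      proof (rule szego_orbit_K_infty[OF that(1,3)])
        have "whole_CMV \<beta> \<in> K_infty" using K that(2) by (simp add: all_right_limits_in_def)
        then show "\<beta> m = 0 \<or> \<beta> n = 0" if "m < n" for m n by (rule K_infty_imp[OF _ that])
      qed
      show ?thesis
        by (rule ratio_asymptotic_if_unique[OF \<alpha>]) (simp_all only: zero)
    next
      assume "\<exists>c. cmod c \<le> 1 \<and> c \<noteq> 0 \<and> unique_right_limit_in \<alpha> (K1_tilde c)"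
      then have phase: "\<exists>\<phi>. \<forall>n. \<beta>' n = cis \<phi> * \<beta> n" if "is_right_limit \<alpha> \<beta>" "is_right_limit \<alpha> \<beta>'" for \<beta> \<beta>'
        using that by (auto simp: unique_right_limit_in_def)
      show ?thesis
      proof (rule ratio_asymptotic_if_unique[OF \<alpha>])
        fix z \<beta> w \<beta>' w'
        assume z: "cmod z < 1" and b: "is_right_limit \<alpha> \<beta>" "szego_orbit z \<beta> w"
          and b': "is_right_limit \<alpha> \<beta>'" "szego_orbit z \<beta>' w'"
        obtain \<phi> where \<phi>: "\<And>n. \<beta>' n = cis \<phi> * \<beta> n" using phase[OF b(1) b'(1)] by blast
        then have "\<beta>' = (\<lambda>n. cis \<phi> * \<beta> n)" by (rule ext)
        then have "szego_orbit z \<beta> (\<lambda>n. cis \<phi> * w' n)"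
          using szego_orbit_phase[of "cis \<phi>" z \<beta> w'] b'(2) by simp
        from szego_orbit_unique[OF z \<beta>1[OF b(1)] b(2) this]
        show "\<beta> 0 * w 0 = \<beta>' 0 * w' 0" by (simp add: \<phi>)
      qed
    qed
  next
    assume "\<exists>z0 \<in> ball 0 1 - {0}. ratio_asymptotics_at (szego_poly \<alpha>) z0 1"
    then obtain z where "z \<in> ball 0 1 - {0}" and ra: "ratio_asymptotics_at (szego_poly \<alpha>) z 1" by blast
    then have z: "cmod z < 1" "z \<noteq> 0" by auto
    show "all_right_limits_in \<alpha> K_infty"
      unfolding all_right_limits_in_def
    proof (intro allI impI)
      fix \<beta> assume b: "is_right_limit \<alpha> \<beta>"
      obtain w where w: "szego_orbit z \<beta> w" "\<And>n. \<beta> n * w n = 0"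
        using ratio_asymptotics_right_limit[OF \<alpha> z ra b] by auto
      note one = szego_orbit_zero_product[OF z(2) w]
      \<comment> \<open>Pairwise vanishing leaves at most one nonzero coefficient; if there is none,
        any site can play the exceptional one.\<close>
      have "\<exists>m. \<forall>k. k \<noteq> m \<longrightarrow> \<beta> k = 0"
      proof (cases "\<exists>m. \<beta> m \<noteq> 0")
        case True
        then obtain m where "\<beta> m \<noteq> 0" by blast
        then have "\<beta> k = 0" if "k \<noteq> m" for k
          using one[of k m] one[of m k] that by (cases "k < m") auto
        then show ?thesis by blast
      qed blast
      then obtain m where "\<And>k. k \<noteq> m \<Longrightarrow> \<beta> k = 0" by blast
      then show "whole_CMV \<beta> \<in> K_infty" by (rule K_infty_if[OF \<beta>1[OF b]])
    qed
  next
    assume "\<exists>z1 \<in> ball 0 1 - {0}. \<exists>z2 \<in> ball 0 1 - {0}. \<exists>G1 G2.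
         z1 \<noteq> z2 \<and> G1 \<noteq> 1 \<and> G2 \<noteq> 1 \<and>
         ratio_asymptotics_at (szego_poly \<alpha>) z1 G1 \<and> ratio_asymptotics_at (szego_poly \<alpha>) z2 G2"
    then obtain z1 z2 G1 G2 where "z1 \<in> ball 0 1 - {0}" "z2 \<in> ball 0 1 - {0}"
      and ne: "z1 \<noteq> z2" "G1 \<noteq> 1" "G2 \<noteq> 1"
      and ra1: "ratio_asymptotics_at (szego_poly \<alpha>) z1 G1" and ra2: "ratio_asymptotics_at (szego_poly \<alpha>) z2 G2"
      by blast
    then have z1: "cmod z1 < 1" "z1 \<noteq> 0" and z2: "cmod z2 < 1" "z2 \<noteq> 0" by auto
    define g1 g2 where "g1 = (1 - G1) / z1" and "g2 = (1 - G2) / z2"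
    have g: "g1 \<noteq> 0" "g2 \<noteq> 0" using ne z1(2) z2(2) by (auto simp: g1_def g2_def)
    \<comment> \<open>This value and the ratio below are built from the two points and their limits
      only, so they are the same for every right limit.\<close>
    define x where "x = (g2 * (1 - z2 * g2) * (z1 * g1) - g1 * (1 - z1 * g1) * (z2 * g2))
        / (g2 * (1 - z2 * g2) - g1 * (1 - z1 * g1))"
    have *: "\<beta> n \<noteq> 0 \<and> \<beta> n * cnj (\<beta> n) = x \<and> \<beta> (n + 1) = g1 * (1 - z1 * g1) / (z1 * g1 - x) * \<beta> n"
      if b: "is_right_limit \<alpha> \<beta>" for \<beta> n
    proof -
      obtain w1 where w1: "szego_orbit z1 \<beta> w1" "\<And>n. \<beta> n * w1 n = g1"
        using ratio_asymptotics_right_limit[OF \<alpha> z1 ra1 b] unfolding g1_def by blast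
      obtain w2 where w2: "szego_orbit z2 \<beta> w2" "\<And>n. \<beta> n * w2 n = g2"
        using ratio_asymptotics_right_limit[OF \<alpha> z2 ra2 b] unfolding g2_def by blast
      show ?thesis unfolding x_def
        using two_point_coeffs[OF z1(1) w1 g(1) z2(1) w2 g(2) \<beta>1[OF b] ne(1)] by blast
    qed
    show "\<exists>c. cmod c \<le> 1 \<and> c \<noteq> 0 \<and> unique_right_limit_in \<alpha> (K1_tilde c)"
    proof (rule unique_right_limit_in_K1_tilde[OF \<alpha>'])
      fix \<beta> n
      assume "is_right_limit \<alpha> \<beta>"
      from *[OF this, of n] show "\<beta> n \<noteq> 0" "\<beta> n * cnj (\<beta> n) = x"
        "\<beta> (n + 1) = g1 * (1 - z1 * g1) / (z1 * g1 - x) * \<beta> n" by blast+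
    qed
  qed
qed

end
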